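(* Let $E$ be a locally compact Polish space and let $T$ be a $\mathcal{C}_b$-semigroup of kernel operators on $\mathcal{B}_b(E)$ of type $(M,\omega)$ consisting of strong Feller operators, with full generator $\hat A$ and Laplace transform $(R(\lambda))_{\operatorname{Re}\lambda>\omega}$. Let $\hat B$ and $\hat B_n$, $n\in\mathds{N}$, be single-valued linear operators with $D(\hat A)$ contained in their domains, each satisfying: (i) for every $t>0$, its composition with $T(t)$, defined on $D(\hat A)$, extends to a kernel operator on $\mathcal{B}_b(E)$; (ii) its composition with $R(\lambda)$ is a kernel operator for all $\lambda>\omega$; (iii) $(t,x)\mapsto \hat BT(t)f(x)$ (resp. with $\hat B_n$) is measurable for $f\in\mathcal{B}_b(E)$; (iv) $\|\hat BT(t)\|$ (resp. $\|\hat B_nT(t)\|$) is bounded by a function integrable near $0$. Assume: (1) $\sup_n\|\hat B_nR(\lambda)\|\to0$ as $\lambda\to\infty$; (2) $\hat B_nR(\lambda)h\rightharpoonup\hat BR(\lambda)h$ for every $h\in\mathcal{B}_b(E)$ and large $\lambda$; (3) $h_n\rightharpoonup0$ implies $\hat B_nR(\lambda)h_n\rightharpoonup0$ for large $\lambda$. Assume additionally that $R(\lambda)\ge0$ for all sufficiently large $\lambda$. Then for all sufficiently large $\lambda$ and every $f\in\mathcal{B}_b(E)$, $(\lambda-(\hat A+\hat B_n))^{-1}f\to(\lambda-(\hat A+\hat B))^{-1}f$ uniformly on compact subsets of $E$.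
   Context: Kernel operator: $Tf(x)=\int f(y)k(x,dy)$ with a bounded kernel. Semigroup of kernel operators of type $(M,\omega)$: kernel operators $T(t)$, $t>0$, with semigroup law, $\|T(t)\|\le Me^{\omega t}$, $(t,x)\mapsto T(t)f(x)$ measurable. $R(\lambda)f(x)=\int_0^\infty e^{-\lambda t}T(t)f(x)dt$. Full generator $\hat A=\{(f,g):T(t)f-f=\int_0^tT(s)g\,ds\ \forall t>0\}$. $\mathcal{C}_b$-semigroup: leaves bounded continuous functions invariant, and $T(t)f\to f$ boundedly pointwise as $t\to0$ for such $f$. Strong Feller: maps bounded measurable into bounded continuous functions. $\hat A+\hat B=\{(u,f+\hat Bu):(u,f)\in\hat A\}$; $(\lambda-(\hat A+\hat B))^{-1}$ is the inverse of the multivalued operator $\lambda-(\hat A+\hat B)$. $h_n\rightharpoonup h$: $\sup_n\|h_n\|_\infty<\infty$ and pointwise convergence (equivalently convergence against all bounded signed measures). *)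

theory Defs
  imports "HOL-Analysis.Analysis"
begin

definition Bb :: "('a::topological_space \<Rightarrow> real) set" where
  "Bb = {f. f \<in> borel_measurable borel \<and> (\<exists>C. \<forall>x. \<bar>f x\<bar> \<le> C)}"

definition Cb :: "('a::topological_space \<Rightarrow> real) set" where
  "Cb = {f. continuous_on UNIV f \<and> (\<exists>C. \<forall>x. \<bar>f x\<bar> \<le> C)}"

definition opn :: "(('a::topological_space \<Rightarrow> real) \<Rightarrow> ('a \<Rightarrow> real)) \<Rightarrow> real" where
  "opn T = (SUP f\<in>{f\<in>Bb. \<forall>x. \<bar>f x\<bar> \<le> 1}. SUP x. \<bar>T f x\<bar>)"

definition signed_measure :: "('a::topological_space set \<Rightarrow> real) \<Rightarrow> bool" where
  "signed_measure \<sigma> \<longleftrightarrow>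
     (\<forall>A::nat \<Rightarrow> 'a set. range A \<subseteq> sets borel \<and> disjoint_family A
        \<longrightarrow> (\<lambda>n. \<sigma> (A n)) sums \<sigma> (\<Union>n. A n))"

text \<open>Integral of f against a signed measure, via a Jordan-type decomposition
  (independent of the chosen decomposition).\<close>
definition signed_integral :: "('a::topological_space set \<Rightarrow> real) \<Rightarrow> ('a \<Rightarrow> real) \<Rightarrow> real" where
  "signed_integral \<sigma> f = (SOME v. \<exists>\<mu> \<nu>. finite_measure \<mu> \<and> finite_measure \<nu> \<and>
      sets \<mu> = sets borel \<and> sets \<nu> = sets borel \<and>
      (\<forall>A\<in>sets borel. \<sigma> A = measure \<mu> A - measure \<nu> A) \<and>
      v = integral\<^sup>L \<mu> f - integral\<^sup>L \<nu> f)"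

definition bounded_kernel :: "('a::topological_space \<Rightarrow> 'a set \<Rightarrow> real) \<Rightarrow> bool" where
  "bounded_kernel k \<longleftrightarrow>
     (\<forall>x. signed_measure (k x)) \<and>
     (\<forall>A\<in>sets borel. (\<lambda>x. k x A) \<in> borel_measurable borel) \<and>
     (\<exists>C. \<forall>x n (A::nat \<Rightarrow> 'a set). (\<forall>i<n. A i \<in> sets borel) \<and> disjoint_family_on A {..<n}
          \<longrightarrow> (\<Sum>i<n. \<bar>k x (A i)\<bar>) \<le> C)"

definition kernel_op :: "(('a::topological_space \<Rightarrow> real) \<Rightarrow> ('a \<Rightarrow> real)) \<Rightarrow> bool" where
  "kernel_op T \<longleftrightarrow> (\<exists>k. bounded_kernel k \<and> (\<forall>f\<in>Bb. \<forall>x. T f x = signed_integral (k x) f))"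

definition kernel_semigroup ::
  "(real \<Rightarrow> ('a::topological_space \<Rightarrow> real) \<Rightarrow> ('a \<Rightarrow> real)) \<Rightarrow> real \<Rightarrow> real \<Rightarrow> bool" where
  "kernel_semigroup T M \<omega> \<longleftrightarrow>
     (\<forall>t>0. kernel_op (T t)) \<and>
     (\<forall>t>0. \<forall>s>0. \<forall>f\<in>Bb. T (t + s) f = T t (T s f)) \<and>
     (\<forall>t>0. opn (T t) \<le> M * exp (\<omega> * t)) \<and>
     (\<forall>f\<in>Bb. (\<lambda>(t, x). T t f x) \<in> borel_measurable (restrict_space borel ({0<..} \<times> UNIV)))"

definition Cb_semigroup :: "(real \<Rightarrow> ('a::topological_space \<Rightarrow> real) \<Rightarrow> ('a \<Rightarrow> real)) \<Rightarrow> bool" where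
  "Cb_semigroup T \<longleftrightarrow>
     (\<forall>t>0. \<forall>f\<in>Cb. T t f \<in> Cb) \<and>
     (\<forall>f\<in>Cb. (\<exists>C \<delta>. \<delta> > 0 \<and> (\<forall>t. 0 < t \<and> t < \<delta> \<longrightarrow> (\<forall>x. \<bar>T t f x\<bar> \<le> C))) \<and>
              (\<forall>x. ((\<lambda>t. T t f x) \<longlongrightarrow> f x) (at_right 0)))"

definition strong_feller :: "(('a::topological_space \<Rightarrow> real) \<Rightarrow> ('a \<Rightarrow> real)) \<Rightarrow> bool" where
  "strong_feller S \<longleftrightarrow> (\<forall>f\<in>Bb. S f \<in> Cb)"

definition laplace :: "(real \<Rightarrow> ('a::topological_space \<Rightarrow> real) \<Rightarrow> ('a \<Rightarrow> real)) \<Rightarrow> real \<Rightarrow> ('a \<Rightarrow> real) \<Rightarrow> ('a \<Rightarrow> real)" where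
  "laplace T lam f x = (LINT t:{0<..}|lborel. exp (- lam * t) * T t f x)"

definition full_gen :: "(real \<Rightarrow> ('a::topological_space \<Rightarrow> real) \<Rightarrow> ('a \<Rightarrow> real)) \<Rightarrow> (('a \<Rightarrow> real) \<times> ('a \<Rightarrow> real)) set" where
  "full_gen T = {(f, g). f \<in> Bb \<and> g \<in> Bb \<and>
      (\<forall>t>0. \<forall>x. T t f x - f x = (LINT s:{0<..t}|lborel. T s g x))}"

definition rel_plus :: "(('a \<Rightarrow> real) \<times> ('a \<Rightarrow> real)) set \<Rightarrow> (('a \<Rightarrow> real) \<Rightarrow> ('a \<Rightarrow> real)) \<Rightarrow> (('a \<Rightarrow> real) \<times> ('a \<Rightarrow> real)) set" where
  "rel_plus A B = {(u, \<lambda>x. f x + B u x) | u f. (u, f) \<in> A}"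

definition lam_minus :: "real \<Rightarrow> (('a \<Rightarrow> real) \<times> ('a \<Rightarrow> real)) set \<Rightarrow> (('a \<Rightarrow> real) \<times> ('a \<Rightarrow> real)) set" where
  "lam_minus lam C = {(u, \<lambda>x. lam * u x - g x) | u g. (u, g) \<in> C}"

definition rel_inv :: "('b \<times> 'b) set \<Rightarrow> ('b \<times> 'b) set" where
  "rel_inv C = {(g, u). (u, g) \<in> C}"

definition bp_conv :: "(nat \<Rightarrow> 'a \<Rightarrow> real) \<Rightarrow> ('a \<Rightarrow> real) \<Rightarrow> bool" where
  "bp_conv hs h \<longleftrightarrow> (\<exists>C. \<forall>n x. \<bar>hs n x\<bar> \<le> C) \<and> (\<forall>x. (\<lambda>n. hs n x) \<longlonglongrightarrow> h x)"

text \<open>Admissible perturbation B w.r.t. T (conditions (i)-(iv)), with BT t the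
  kernel-operator extension of B T(t) from D(A).\<close>
definition admissible_pert ::
  "(real \<Rightarrow> ('a::topological_space \<Rightarrow> real) \<Rightarrow> ('a \<Rightarrow> real)) \<Rightarrow> real \<Rightarrow>
   (('a \<Rightarrow> real) \<Rightarrow> ('a \<Rightarrow> real)) \<Rightarrow> (real \<Rightarrow> ('a \<Rightarrow> real) \<Rightarrow> ('a \<Rightarrow> real)) \<Rightarrow> bool" where
  "admissible_pert T \<omega> B BT \<longleftrightarrow>
     (\<forall>f\<in>Domain (full_gen T). B f \<in> Bb) \<and>
     (\<forall>f\<in>Domain (full_gen T). \<forall>g\<in>Domain (full_gen T). \<forall>c a.
        B (\<lambda>x. c * f x + a * g x) = (\<lambda>x. c * B f x + a * B g x)) \<and>
     (\<forall>t>0. kernel_op (BT t) \<and> (\<forall>f\<in>Domain (full_gen T). BT t f = B (T t f))) \<and>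
     (\<forall>lam>\<omega>. kernel_op (\<lambda>f. B (laplace T lam f))) \<and>
     (\<forall>f\<in>Bb. (\<lambda>(t, x). BT t f x) \<in> borel_measurable (restrict_space borel ({0<..} \<times> UNIV))) \<and>
     (\<exists>\<phi> \<delta>. \<delta> > 0 \<and> set_integrable lborel {0<..<\<delta>} \<phi> \<and> (\<forall>t>0. opn (BT t) \<le> \<phi> t))"

end

theory Submission
  imports Defs
begin

text \<open>For large \<open>\<lambda>\<close> the operator \<open>B R(\<lambda>)\<close> is a contraction on bounded measurable
  functions, so \<open>(\<lambda> - (A + B))\<^sup>-\<^sup>1 f = R(\<lambda>) w\<close> where \<open>w = f + B R(\<lambda>) w\<close>; this uses that
  \<open>R(\<lambda>)\<close> inverts \<open>\<lambda> - A\<close> on the full generator.  The same holds for each \<open>B\<^sub>n\<close>, and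
  hypotheses (2) and (3) make the fixed points \<open>w\<^sub>n\<close> converge to \<open>w\<close> boundedly pointwise.
  Finally \<open>R(\<lambda>)\<close> is positive and maps into continuous functions (strong Feller), so by
  Dini's theorem it turns bounded pointwise convergence into uniform convergence on compacts.\<close>

section \<open>Signed measures\<close>

lemma signed_measure_empty:
  assumes "signed_measure \<sigma>" shows "\<sigma> {} = 0"
proof -
  have "(\<lambda>n. \<sigma> {}) sums \<sigma> (\<Union>n. {})"
    using assms unfolding signed_measure_def by (auto simp: disjoint_family_on_def)
  then have "(\<lambda>n. \<sigma> {}) \<longlonglongrightarrow> 0" by (simp add: sums_summable summable_LIMSEQ_zero)
  then show ?thesis using LIMSEQ_const_iff by blast
qed

lemma signed_measure_finite_additive:
  fixes F :: "nat \<Rightarrow> 'a::topological_space set"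
  assumes "signed_measure \<sigma>" "\<And>i. i < n \<Longrightarrow> F i \<in> sets borel" "disjoint_family_on F {..<n}"
  shows "\<sigma> (\<Union>i<n. F i) = (\<Sum>i<n. \<sigma> (F i))"
proof -
  define G where "G i = (if i < n then F i else {})" for i
  have "range G \<subseteq> sets borel" "disjoint_family G"
    using assms(2,3) by (auto simp: G_def disjoint_family_on_def)
  then have "(\<lambda>i. \<sigma> (G i)) sums \<sigma> (\<Union>i. G i)"
    using assms(1) unfolding signed_measure_def by blast
  moreover have "(\<Union>i. G i) = (\<Union>i<n. F i)" by (auto simp: G_def split: if_splits)
  moreover have "(\<lambda>i. \<sigma> (G i)) = (\<lambda>i. if i \<in> {..<n} then \<sigma> (F i) else 0)"
    using signed_measure_empty[OF assms(1)] by (auto simp: G_def)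
  moreover have "(\<lambda>i. if i \<in> {..<n} then \<sigma> (F i) else 0) sums (\<Sum>i<n. \<sigma> (F i))"
    by (rule sums_If_finite_set) simp
  ultimately show ?thesis using sums_unique2 by metis
qed

lemma signed_measure_Un:
  assumes "signed_measure \<sigma>" "A \<in> sets borel" "B \<in> sets borel" "A \<inter> B = {}"
  shows "\<sigma> (A \<union> B) = \<sigma> A + \<sigma> B"
proof -
  define F where "F i = (if i = 0 then A else B)" for i :: nat
  have "\<sigma> (\<Union>i<2. F i) = (\<Sum>i<2. \<sigma> (F i))"
    using assms by (intro signed_measure_finite_additive) (auto simp: F_def disjoint_family_on_def)
  moreover have "(\<Union>i<2. F i) = A \<union> B" by (auto simp: F_def eval_nat_numeral lessThan_Suc)
  ultimately show ?thesis by (simp add: F_def eval_nat_numeral lessThan_Suc)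
qed

lemma signed_measure_Diff:
  assumes "signed_measure \<sigma>" "A \<in> sets borel" "B \<in> sets borel"
  shows "\<sigma> (A - B) = \<sigma> A - \<sigma> (A \<inter> B)"
proof -
  have "(A - B) \<union> (A \<inter> B) = A" "(A - B) \<inter> (A \<inter> B) = {}" by blast+
  then show ?thesis using signed_measure_Un[OF assms(1), of "A - B" "A \<inter> B"] assms by auto
qed

lemma signed_measure_Lim_incseq:
  assumes "signed_measure \<sigma>" "\<And>i. A i \<in> sets borel" "incseq A"
  shows "(\<lambda>n. \<sigma> (A n)) \<longlonglongrightarrow> \<sigma> (\<Union>n. A n)"
proof -
  have r: "range (disjointed A) \<subseteq> sets borel"
    using assms(2) by (intro sets.range_disjointed_sets) auto
  have "(\<lambda>i. \<sigma> (disjointed A i)) sums \<sigma> (\<Union>i. disjointed A i)"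
    using assms(1) r disjoint_family_disjointed unfolding signed_measure_def by blast
  then have "(\<lambda>n. \<Sum>i<n. \<sigma> (disjointed A i)) \<longlonglongrightarrow> \<sigma> (\<Union>i. A i)"
    by (simp add: sums_def UN_disjointed_eq)
  moreover have "(\<Sum>i<Suc n. \<sigma> (disjointed A i)) = \<sigma> (A n)" for n
  proof -
    have "(\<Sum>i<Suc n. \<sigma> (disjointed A i)) = \<sigma> (\<Union>i<Suc n. disjointed A i)"
      using r by (intro signed_measure_finite_additive[symmetric] assms(1))
        (auto intro: disjoint_family_on_mono[OF _ disjoint_family_disjointed])
    also have "(\<Union>i<Suc n. disjointed A i) = (\<Union>i\<in>{0..<Suc n}. A i)"
      using finite_UN_disjointed_eq by (simp add: lessThan_atLeast0)
    also have "\<dots> = A n"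
      using assms(3) by (auto simp: incseq_def less_Suc_eq_le) blast
    finally show ?thesis .
  qed
  ultimately show ?thesis
    using LIMSEQ_Suc[of "\<lambda>n. \<Sum>i<n. \<sigma> (disjointed A i)"] by simp
qed

lemma signed_measure_Lim_decseq:
  assumes "signed_measure \<sigma>" "\<And>i. A i \<in> sets borel" "decseq A"
  shows "(\<lambda>n. \<sigma> (A n)) \<longlonglongrightarrow> \<sigma> (\<Inter>n. A n)"
proof -
  have "incseq (\<lambda>n. A 0 - A n)" using assms(3) by (auto simp: incseq_def decseq_def)
  then have "(\<lambda>n. \<sigma> (A 0 - A n)) \<longlonglongrightarrow> \<sigma> (\<Union>n. A 0 - A n)"
    using assms(2) by (intro signed_measure_Lim_incseq[OF assms(1)]) auto
  moreover have "\<sigma> (A 0 - A n) = \<sigma> (A 0) - \<sigma> (A n)" for n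
  proof -
    have "A 0 \<inter> A n = A n" using assms(3) by (auto simp: decseq_def)
    then show ?thesis using signed_measure_Diff[OF assms(1) assms(2) assms(2)] by metis
  qed
  moreover have "\<sigma> (\<Union>n. A 0 - A n) = \<sigma> (A 0) - \<sigma> (\<Inter>n. A n)"
  proof -
    have "(\<Union>n. A 0 - A n) = A 0 - (\<Inter>n. A n)" "A 0 \<inter> (\<Inter>n. A n) = (\<Inter>n. A n)" by auto
    moreover have "(\<Inter>n. A n) \<in> sets borel" using assms(2) by auto
    ultimately show ?thesis using signed_measure_Diff[OF assms(1) assms(2)[of 0]] by metis
  qed
  ultimately have "(\<lambda>n. \<sigma> (A 0) - \<sigma> (A n)) \<longlonglongrightarrow> \<sigma> (A 0) - \<sigma> (\<Inter>n. A n)"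
    by simp
  from tendsto_diff[OF tendsto_const[of "\<sigma> (A 0)"] this] show ?thesis by simp
qed

lemma signed_measure_INT_near_sup:
  assumes sm: "signed_measure \<sigma>" and \<gamma>: "\<And>X. X \<in> sets borel \<Longrightarrow> \<sigma> X \<le> \<gamma>"
    and Es: "\<And>i. E i \<in> sets borel" and E: "\<And>i. \<gamma> - 1 / 2 ^ i < \<sigma> (E i)" and "m \<le> n"
  shows "\<gamma> - 2 / 2 ^ m + 1 / 2 ^ n \<le> \<sigma> (\<Inter>i\<in>{m..n}. E i)"
  using \<open>m \<le> n\<close>
proof (induct rule: dec_induct)
  case base
  then show ?case using E[of m] by (simp add: field_simps)
next
  case (step n)
  define F where "F = (\<Inter>i\<in>{m..n}. E i)"
  have F: "F \<in> sets borel" using Es \<open>m \<le> n\<close> by (auto simp: F_def)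
  have F_Suc: "(\<Inter>i\<in>{m..Suc n}. E i) = F \<inter> E (Suc n)"
    using \<open>m \<le> n\<close> by (auto simp: F_def le_Suc_eq)
  have "\<gamma> + (\<gamma> - 2 / 2^m + 1 / 2 ^ Suc n) \<le> (\<gamma> - 1 / 2^Suc n) + (\<gamma> - 2 / 2^m + 1 / 2^n)"
    by (simp add: field_simps)
  also have "\<dots> \<le> \<sigma> (E (Suc n)) + \<sigma> F"
    using E[of "Suc n"] step(3) by (simp add: F_def)
  also have "\<dots> = \<sigma> (E (Suc n)) + \<sigma> (F - E (Suc n)) + \<sigma> (F \<inter> E (Suc n))"
    using signed_measure_Diff[OF sm F Es] by simp
  also have "\<dots> = \<sigma> (E (Suc n) \<union> F) + \<sigma> (F \<inter> E (Suc n))"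
    using signed_measure_Un[OF sm Es[of "Suc n"], of "F - E (Suc n)"] F Es[of "Suc n"]
    by (simp add: Un_Diff_cancel)
  also have "\<dots> \<le> \<gamma> + \<sigma> (F \<inter> E (Suc n))"
    using Es F \<gamma> by auto
  finally show ?case by (simp add: F_Suc)
qed

lemma signed_measure_limsup_ge_sup:
  assumes sm: "signed_measure \<sigma>" and \<gamma>: "\<And>X. X \<in> sets borel \<Longrightarrow> \<sigma> X \<le> \<gamma>"
    and Es: "\<And>i. E i \<in> sets borel" and E: "\<And>i. \<gamma> - 1 / 2 ^ i < \<sigma> (E i)"
  shows "\<gamma> \<le> \<sigma> (\<Union>m. \<Inter>i\<in>{m..}. E i)"
proof -
  define F where "F m n = (\<Inter>i\<in>{m..n}. E i)" for m n
  have Fs: "F m n \<in> sets borel" for m n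
    using Es by (cases "m \<le> n") (auto simp: F_def)
  note F_ge = signed_measure_INT_near_sup[OF sm \<gamma> Es E, folded F_def]
  define F' where "F' m = (\<Inter>i\<in>{m..}. E i)" for m
  have F'_eq: "F' m = (\<Inter>i. F m (i + m))" for m
    by (fastforce simp: le_iff_add[of m] F'_def F_def)
  have F's: "F' m \<in> sets borel" for m
    using Es by (auto simp: F'_def)
  have "\<gamma> - 0 \<le> \<sigma> (\<Union>m. F' m)"
  proof (rule LIMSEQ_le)
    show "(\<lambda>n. \<gamma> - 2 / 2 ^ n) \<longlonglongrightarrow> \<gamma> - 0"
      by (intro tendsto_intros LIMSEQ_divide_realpow_zero) auto
    have "incseq F'"
      by (auto simp: incseq_def F'_def)
    then show "(\<lambda>m. \<sigma> (F' m)) \<longlonglongrightarrow> \<sigma> (\<Union>m. F' m)"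
      by (rule signed_measure_Lim_incseq[OF sm F's])
    have "\<gamma> - 2 / 2 ^ m + 0 \<le> \<sigma> (F' m)" for m
    proof (rule LIMSEQ_le)
      have *: "decseq (\<lambda>n. F m (n + m))"
        by (auto simp: decseq_def F_def)
      show "(\<lambda>n. \<sigma> (F m n)) \<longlonglongrightarrow> \<sigma> (F' m)"
        unfolding F'_eq
        by (rule LIMSEQ_offset[where k=m]) (rule signed_measure_Lim_decseq[OF sm Fs *])
      show "(\<lambda>n. \<gamma> - 2 / 2 ^ m + 1 / 2 ^ n) \<longlonglongrightarrow> \<gamma> - 2 / 2 ^ m + 0"
        by (intro tendsto_add LIMSEQ_divide_realpow_zero tendsto_const) auto
      show "\<exists>N. \<forall>n\<ge>N. \<gamma> - 2 / 2 ^ m + 1 / 2 ^ n \<le> \<sigma> (F m n)"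
        using F_ge[of m] by (intro exI[of _ m]) auto
    qed
    then show "\<exists>N. \<forall>n\<ge>N. \<gamma> - 2 / 2 ^ n \<le> \<sigma> (F' n)"
      by auto
  qed
  then show ?thesis by (simp add: F'_def)
qed

text \<open>As in \<open>finite_unsigned_Hahn_decomposition\<close>: the positive set is the union of the
  sets \<open>\<Inter>i\<ge>m. E i\<close>, where \<open>\<sigma> (E i)\<close> comes within \<open>2\<^sup>-\<^sup>i\<close> of \<open>\<gamma> = sup \<sigma>\<close>.\<close>
lemma signed_measure_Hahn_decomposition:
  fixes \<sigma> :: "'a::topological_space set \<Rightarrow> real"
  assumes sm: "signed_measure \<sigma>" and bd: "\<And>A. A \<in> sets borel \<Longrightarrow> \<sigma> A \<le> C"
  shows "\<exists>Y\<in>sets borel. (\<forall>X\<in>sets borel. X \<subseteq> Y \<longrightarrow> 0 \<le> \<sigma> X) \<and>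
                        (\<forall>X\<in>sets borel. X \<inter> Y = {} \<longrightarrow> \<sigma> X \<le> 0)"
proof -
  let ?S = "sets (borel :: 'a measure)"
  have bdd: "bdd_above (\<sigma>`?S)"
    using bd by (auto intro!: bdd_aboveI[where M=C])
  define \<gamma> where "\<gamma> = (SUP X\<in>?S. \<sigma> X)"
  have le_\<gamma>: "X \<in> ?S \<Longrightarrow> \<sigma> X \<le> \<gamma>" for X
    using bdd by (auto simp: \<gamma>_def intro!: cSUP_upper)
  have "\<exists>X\<in>?S. \<gamma> - 1 / 2^n < \<sigma> X" for n
    unfolding \<gamma>_def using bdd by (intro less_cSUP_iff[THEN iffD1]) auto
  then obtain E where Es: "\<And>n. E n \<in> ?S" and E: "\<And>n. \<gamma> - 1 / 2^n < \<sigma> (E n)"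
    by metis
  define Y where "Y = (\<Union>m. \<Inter>i\<in>{m..}. E i)"
  have Y: "Y \<in> ?S" using Es by (auto simp: Y_def)
  have \<gamma>_le: "\<gamma> \<le> \<sigma> Y"
    unfolding Y_def by (rule signed_measure_limsup_ge_sup[OF sm le_\<gamma> Es E])
  show ?thesis
  proof (intro bexI[OF _ Y] conjI ballI impI)
    fix X assume Xs: "X \<in> ?S" and X: "X \<subseteq> Y"
    then have "Y \<inter> X = X" by blast
    then have "\<sigma> Y - \<sigma> X = \<sigma> (Y - X)"
      using signed_measure_Diff[OF sm Y Xs] by simp
    also have "\<dots> \<le> \<gamma>"
      using Y Xs by (auto intro: le_\<gamma>)
    finally show "0 \<le> \<sigma> X"
      using \<gamma>_le by auto
  next
    fix X assume Xs: "X \<in> ?S" and X: "X \<inter> Y = {}"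
    then have "\<sigma> Y + \<sigma> X = \<sigma> (X \<union> Y)"
      using signed_measure_Un[OF sm Y Xs] by (simp add: Int_commute Un_commute)
    also have "\<dots> \<le> \<gamma>"
      using Y Xs by (auto intro: le_\<gamma>)
    finally show "\<sigma> X \<le> 0"
      using \<gamma>_le by auto
  qed
qed

lemma signed_measure_restrict:
  assumes "signed_measure \<sigma>" "Y \<in> sets borel"
  shows "signed_measure (\<lambda>A. \<sigma> (A \<inter> Y))"
  unfolding signed_measure_def
proof (intro allI impI)
  fix A :: "nat \<Rightarrow> 'a set" assume A: "range A \<subseteq> sets borel \<and> disjoint_family A"
  then have "range (\<lambda>i. A i \<inter> Y) \<subseteq> sets borel" "disjoint_family (\<lambda>i. A i \<inter> Y)"
    using assms(2) by (auto simp: disjoint_family_on_def)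
  then have "(\<lambda>i. \<sigma> (A i \<inter> Y)) sums \<sigma> (\<Union>i. A i \<inter> Y)"
    using assms(1) unfolding signed_measure_def by blast
  then show "(\<lambda>i. \<sigma> (A i \<inter> Y)) sums \<sigma> ((\<Union>i. A i) \<inter> Y)" by simp
qed

lemma signed_measure_uminus:
  assumes "signed_measure \<sigma>" shows "signed_measure (\<lambda>A. - \<sigma> A)"
  using assms unfolding signed_measure_def by (auto intro: sums_minus)

definition finite_borel_measure :: "'a::topological_space measure \<Rightarrow> bool" where
  "finite_borel_measure m \<longleftrightarrow> finite_measure m \<and> sets m = sets borel"

lemma measure_of_nonneg_signed_measure:
  fixes \<tau> :: "'a::topological_space set \<Rightarrow> real"
  assumes sm: "signed_measure \<tau>" and nn: "\<And>A. A \<in> sets borel \<Longrightarrow> 0 \<le> \<tau> A"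
  defines "M \<equiv> measure_of UNIV (sets borel) (\<lambda>A. ennreal (\<tau> A))"
  shows "finite_borel_measure M" "\<And>A. A \<in> sets borel \<Longrightarrow> measure M A = \<tau> A"
proof -
  have sa: "sigma_algebra UNIV (sets (borel::'a measure))"
    by (metis sets.sigma_algebra_axioms space_borel)
  have pos: "positive (sets borel) (\<lambda>A. ennreal (\<tau> A))"
    unfolding positive_def using signed_measure_empty[OF sm] by simp
  have ca: "countably_additive (sets borel) (\<lambda>A. ennreal (\<tau> A))"
    unfolding countably_additive_def
  proof (intro allI impI)
    fix A :: "nat \<Rightarrow> 'a set" assume A: "range A \<subseteq> sets borel" "disjoint_family A"
    then have s: "(\<lambda>i. \<tau> (A i)) sums \<tau> (\<Union>i. A i)" using sm unfolding signed_measure_def by blast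
    then have "(\<Sum>i. ennreal (\<tau> (A i))) = ennreal (\<Sum>i. \<tau> (A i))"
      using A nn by (intro suminf_ennreal2) (auto simp: sums_summable)
    then show "(\<Sum>i. ennreal (\<tau> (A i))) = ennreal (\<tau> (\<Union> (range A)))"
      using s sums_unique by metis
  qed
  have em: "emeasure M A = ennreal (\<tau> A)" if "A \<in> sets borel" for A
    unfolding M_def by (rule emeasure_measure_of_sigma[OF sa pos ca that])
  have "finite_measure M"
    using em[of UNIV] by (intro finite_measureI) (simp add: M_def)
  moreover have "sets M = sets borel" unfolding M_def
    by (metis sets.sets_measure_of_eq space_borel)
  ultimately show "finite_borel_measure M"
    by (simp add: finite_borel_measure_def)
  show "measure M A = \<tau> A" if "A \<in> sets borel" for A
    using em[OF that] nn[OF that] by (simp add: measure_def)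
qed

definition jordan_pair :: "('a::topological_space set \<Rightarrow> real) \<Rightarrow> 'a measure \<Rightarrow> 'a measure \<Rightarrow> bool" where
  "jordan_pair \<sigma> \<mu> \<nu> \<longleftrightarrow> finite_borel_measure \<mu> \<and> finite_borel_measure \<nu> \<and>
      (\<forall>A\<in>sets borel. \<sigma> A = measure \<mu> A - measure \<nu> A)"

lemma signed_measure_Jordan_decomposition:
  fixes \<sigma> :: "'a::topological_space set \<Rightarrow> real"
  assumes sm: "signed_measure \<sigma>"
    and bd: "\<forall>n (A::nat \<Rightarrow> 'a set). (\<forall>i<n. A i \<in> sets borel) \<and> disjoint_family_on A {..<n}
          \<longrightarrow> (\<Sum>i<n. \<bar>\<sigma> (A i)\<bar>) \<le> C"
  shows "\<exists>\<mu> \<nu>. jordan_pair \<sigma> \<mu> \<nu> \<and> measure \<mu> UNIV + measure \<nu> UNIV \<le> C"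
proof -
  have "\<sigma> A \<le> C" if "A \<in> sets borel" for A
    using bd[rule_format, of 1 "\<lambda>_. A"] that by (auto simp: disjoint_family_on_def)
  then obtain Y where Y: "Y \<in> sets borel" and Yp: "\<forall>X\<in>sets borel. X \<subseteq> Y \<longrightarrow> 0 \<le> \<sigma> X"
    and Yn: "\<forall>X\<in>sets borel. X \<inter> Y = {} \<longrightarrow> \<sigma> X \<le> 0"
    using signed_measure_Hahn_decomposition[OF sm] by blast
  have nY: "- Y \<in> sets borel" using Y by auto
  define \<mu> where "\<mu> = measure_of UNIV (sets borel) (\<lambda>A. ennreal (\<sigma> (A \<inter> Y)))"
  define \<nu> where "\<nu> = measure_of UNIV (sets borel) (\<lambda>A. ennreal (- \<sigma> (A \<inter> - Y)))"
  have "0 \<le> \<sigma> (A \<inter> Y)" if "A \<in> sets borel" for A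
    using Yp that Y by auto
  note \<mu>_meas = measure_of_nonneg_signed_measure[OF signed_measure_restrict[OF sm Y] this, folded \<mu>_def]
  have "0 \<le> - \<sigma> (A \<inter> - Y)" if "A \<in> sets borel" for A
    using Yn that nY by auto
  note \<nu>_meas = measure_of_nonneg_signed_measure[OF signed_measure_uminus[OF signed_measure_restrict[OF sm nY]] this,
      folded \<nu>_def]
  have "\<sigma> A = \<sigma> (A \<inter> Y) + \<sigma> (A \<inter> - Y)" if "A \<in> sets borel" for A
  proof -
    have "A = (A \<inter> Y) \<union> (A \<inter> - Y)" "(A \<inter> Y) \<inter> (A \<inter> - Y) = {}" by blast+
    moreover have "A \<inter> Y \<in> sets borel" "A \<inter> - Y \<in> sets borel" using that Y nY by auto
    ultimately show ?thesis using signed_measure_Un[OF sm, of "A \<inter> Y" "A \<inter> - Y"] by metis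
  qed
  then have "jordan_pair \<sigma> \<mu> \<nu>"
    unfolding jordan_pair_def using \<mu>_meas \<nu>_meas by simp
  moreover have "\<bar>\<sigma> Y\<bar> + \<bar>\<sigma> (- Y)\<bar> \<le> C"
    using bd[rule_format, of 2 "\<lambda>i. if i = 0 then Y else - Y"] Y nY
    by (auto simp: disjoint_family_on_def eval_nat_numeral lessThan_Suc less_Suc_eq)
  then have "measure \<mu> UNIV + measure \<nu> UNIV \<le> C"
    using \<mu>_meas(2)[of UNIV] \<nu>_meas(2)[of UNIV] by simp
  ultimately show ?thesis by blast
qed

section \<open>Kernel operators\<close>

lemma Bb_lincomb: "f \<in> Bb \<Longrightarrow> g \<in> Bb \<Longrightarrow> (\<lambda>y. a * f y + b * g y) \<in> Bb"
proof -
  assume f: "f \<in> Bb" and g: "g \<in> Bb"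
  obtain C D where C: "\<forall>y. \<bar>f y\<bar> \<le> C" and D: "\<forall>y. \<bar>g y\<bar> \<le> D"
    using f g unfolding Bb_def by blast
  have "\<bar>a * f y + b * g y\<bar> \<le> \<bar>a\<bar> * C + \<bar>b\<bar> * D" for y
  proof -
    have "\<bar>a * f y + b * g y\<bar> \<le> \<bar>a\<bar> * \<bar>f y\<bar> + \<bar>b\<bar> * \<bar>g y\<bar>"
      by (simp add: abs_mult abs_triangle_ineq[THEN order_trans])
    also have "\<dots> \<le> \<bar>a\<bar> * C + \<bar>b\<bar> * D" using C D by (intro add_mono mult_left_mono) auto
    finally show ?thesis .
  qed
  moreover have "(\<lambda>y. a * f y + b * g y) \<in> borel_measurable borel" using f g unfolding Bb_def by auto
  ultimately show ?thesis unfolding Bb_def by blast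
qed

lemma Bb_const: "(\<lambda>y. c) \<in> Bb"
  unfolding Bb_def by (auto intro: exI[of _ "\<bar>c\<bar>"])

lemma Bb_scale: "f \<in> Bb \<Longrightarrow> (\<lambda>y. a * f y) \<in> Bb"
  using Bb_lincomb[of f f a 0] by simp

lemma Bb_diff: "f \<in> Bb \<Longrightarrow> g \<in> Bb \<Longrightarrow> (\<lambda>y. f y - g y) \<in> Bb"
  using Bb_lincomb[of f g 1 "-1"] by simp

lemma Bb_add: "f \<in> Bb \<Longrightarrow> g \<in> Bb \<Longrightarrow> (\<lambda>y. f y + g y) \<in> Bb"
  using Bb_lincomb[of f g 1 1] by simp

lemma finite_borel_measure_measurable:
  "finite_borel_measure m \<Longrightarrow> f \<in> borel_measurable borel \<Longrightarrow> f \<in> borel_measurable m"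
  unfolding finite_borel_measure_def using measurable_cong_sets[of m borel borel borel] by blast

lemma finite_borel_measure_integrable:
  fixes f :: "'a::topological_space \<Rightarrow> real"
  assumes "finite_borel_measure m" "f \<in> borel_measurable borel" "\<And>x. \<bar>f x\<bar> \<le> B"
  shows "integrable m f"
  using assms finite_borel_measure_measurable[OF assms(1,2)] unfolding finite_borel_measure_def
  by (intro finite_measure.integrable_const_bound[where B=B]) auto

lemma finite_borel_measure_Bb_integrable:
  "finite_borel_measure m \<Longrightarrow> f \<in> Bb \<Longrightarrow> integrable m f"
  unfolding Bb_def using finite_borel_measure_integrable by blast

lemma finite_borel_measure_abs_integral_le:
  fixes f :: "'a::topological_space \<Rightarrow> real"
  assumes m: "finite_borel_measure m" and f: "f \<in> borel_measurable borel" "\<And>y. \<bar>f y\<bar> \<le> B"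
  shows "\<bar>integral\<^sup>L m f\<bar> \<le> B * measure m UNIV"
proof -
  have fm: "finite_measure m" and sp: "space m = UNIV"
    using m sets_eq_imp_space_eq unfolding finite_borel_measure_def by fastforce+
  have "\<bar>integral\<^sup>L m f\<bar> \<le> integral\<^sup>L m (\<lambda>y. \<bar>f y\<bar>)" by (rule integral_abs_bound)
  also have "\<dots> \<le> integral\<^sup>L m (\<lambda>y. B)"
    using finite_borel_measure_integrable[OF m f] f(2) finite_measure.integrable_const[OF fm]
    by (intro integral_mono) auto
  also have "\<dots> = B * measure m UNIV" using sp by simp
  finally show ?thesis .
qed

lemma finite_borel_measure_bounded_convergence:
  fixes U :: "nat \<Rightarrow> 'a::topological_space \<Rightarrow> real"
  assumes m: "finite_borel_measure m"
    and U: "\<And>i. U i \<in> borel_measurable borel" and u: "u \<in> borel_measurable borel"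
    and b: "\<And>i x. \<bar>U i x\<bar> \<le> B" and l: "\<And>x. (\<lambda>i. U i x) \<longlonglongrightarrow> u x"
  shows "(\<lambda>i. integral\<^sup>L m (U i)) \<longlonglongrightarrow> integral\<^sup>L m u"
proof (rule integral_dominated_convergence[where w="\<lambda>_. B"])
  show "integrable m (\<lambda>_. B)"
    using m unfolding finite_borel_measure_def by (simp add: finite_measure.integrable_const)
qed (use finite_borel_measure_measurable[OF m] U u b l in auto)

lemma integral_balance_LIMSEQ:
  fixes U :: "nat \<Rightarrow> 'a::topological_space \<Rightarrow> real"
  assumes m: "finite_borel_measure m1" "finite_borel_measure m2" "finite_borel_measure m3" "finite_borel_measure m4"
    and U: "\<And>i. U i \<in> borel_measurable borel" and u: "u \<in> borel_measurable borel"
    and b: "\<And>i x. \<bar>U i x\<bar> \<le> B" and l: "\<And>x. (\<lambda>i. U i x) \<longlonglongrightarrow> u x"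
    and eq: "\<And>i. integral\<^sup>L m1 (U i) + integral\<^sup>L m2 (U i) = integral\<^sup>L m3 (U i) + integral\<^sup>L m4 (U i)"
  shows "integral\<^sup>L m1 u + integral\<^sup>L m2 u = integral\<^sup>L m3 u + integral\<^sup>L m4 u"
proof -
  have l: "(\<lambda>i. integral\<^sup>L m (U i)) \<longlonglongrightarrow> integral\<^sup>L m u" if "finite_borel_measure m" for m
    using that U u b l by (rule finite_borel_measure_bounded_convergence)
  have "(\<lambda>i. integral\<^sup>L m1 (U i) + integral\<^sup>L m2 (U i)) \<longlonglongrightarrow> integral\<^sup>L m1 u + integral\<^sup>L m2 u"
    using l m by (intro tendsto_add) auto
  moreover have "(\<lambda>i. integral\<^sup>L m1 (U i) + integral\<^sup>L m2 (U i)) \<longlonglongrightarrow> integral\<^sup>L m3 u + integral\<^sup>L m4 u"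
    unfolding eq using l m by (intro tendsto_add) auto
  ultimately show ?thesis using LIMSEQ_unique by blast
qed

text \<open>The boundedness hypothesis sits inside the induction predicate because
  \<open>borel_measurable_induct_real\<close> also produces unbounded functions.\<close>
lemma integral_balance_nonneg:
  fixes u :: "'a::topological_space \<Rightarrow> real"
  assumes m: "finite_borel_measure m1" "finite_borel_measure m2" "finite_borel_measure m3" "finite_borel_measure m4"
    and eq: "\<And>A. A \<in> sets borel \<Longrightarrow> measure m1 A + measure m2 A = measure m3 A + measure m4 A"
    and u: "u \<in> borel_measurable borel" "\<And>x. 0 \<le> u x"
  shows "(\<exists>B. \<forall>x. u x \<le> B) \<longrightarrow> integral\<^sup>L m1 u + integral\<^sup>L m2 u = integral\<^sup>L m3 u + integral\<^sup>L m4 u"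
  using u
proof (induction rule: borel_measurable_induct_real)
  case (set A)
  then show ?case using eq[OF set] m
    by (simp add: finite_borel_measure_def finite_measure.emeasure_finite)
next
  case (mult u c)
  show ?case
  proof (cases "c = 0")
    case False
    show ?thesis
    proof
      assume "\<exists>B. \<forall>x. c * u x \<le> B"
      then obtain B where "\<And>x. c * u x \<le> B" by blast
      then have "u x \<le> B / c" for x using False mult(1) by (simp add: pos_le_divide_eq mult.commute)
      then show "integral\<^sup>L m1 (\<lambda>x. c * u x) + integral\<^sup>L m2 (\<lambda>x. c * u x) =
                 integral\<^sup>L m3 (\<lambda>x. c * u x) + integral\<^sup>L m4 (\<lambda>x. c * u x)"
        using mult(4) by (auto simp: distrib_left[symmetric])
    qed
  qed simp
next
  case (add u v)
  show ?case
  proof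
    assume "\<exists>B. \<forall>x. v x + u x \<le> B"
    then obtain B where B: "\<And>x. v x + u x \<le> B" by blast
    have bu: "\<bar>u x\<bar> \<le> B" "\<bar>v x\<bar> \<le> B" for x using B[of x] add.hyps(2)[of x] add.hyps(4)[of x] by auto
    have i: "integrable m u" "integrable m v" if "finite_borel_measure m" for m
      using that bu add.hyps(1,3) by (auto intro: finite_borel_measure_integrable)
    have "\<exists>B. \<forall>x. u x \<le> B" "\<exists>B. \<forall>x. v x \<le> B"
      using bu by (meson abs_le_D1)+
    then have "integral\<^sup>L m1 u + integral\<^sup>L m2 u = integral\<^sup>L m3 u + integral\<^sup>L m4 u"
      "integral\<^sup>L m1 v + integral\<^sup>L m2 v = integral\<^sup>L m3 v + integral\<^sup>L m4 v"
      using add.IH by blast+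
    then show "integral\<^sup>L m1 (\<lambda>x. v x + u x) + integral\<^sup>L m2 (\<lambda>x. v x + u x) =
               integral\<^sup>L m3 (\<lambda>x. v x + u x) + integral\<^sup>L m4 (\<lambda>x. v x + u x)"
      using i[OF m(1)] i[OF m(2)] i[OF m(3)] i[OF m(4)] by (simp add: integral_add)
  qed
next
  case (seq U)
  show ?case
  proof
    assume "\<exists>B. \<forall>x. u x \<le> B"
    then obtain B where B: "\<And>x. u x \<le> B" by blast
    have lim: "(\<lambda>i. U i x) \<longlonglongrightarrow> u x" for x
      using seq.hyps(4) by simp
    have le: "U i x \<le> u x" for i x
      using seq.hyps(3) by (intro incseq_le[OF _ lim]) (auto simp: incseq_def le_fun_def)
    have bU: "\<bar>U i x\<bar> \<le> B" for i x using le[of i x] B[of x] seq.hyps(2)[of i x] by auto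
    then have "\<exists>B. \<forall>x. U i x \<le> B" for i by (meson abs_le_D1)
    then show "integral\<^sup>L m1 u + integral\<^sup>L m2 u = integral\<^sup>L m3 u + integral\<^sup>L m4 u"
      using seq.IH by (intro integral_balance_LIMSEQ[OF m seq.hyps(1) u(1) bU lim]) blast
  qed
qed

lemma integral_balance:
  fixes f :: "'a::topological_space \<Rightarrow> real"
  assumes m: "finite_borel_measure m1" "finite_borel_measure m2" "finite_borel_measure m3" "finite_borel_measure m4"
    and eq: "\<And>A. A \<in> sets borel \<Longrightarrow> measure m1 A + measure m2 A = measure m3 A + measure m4 A"
    and f: "f \<in> Bb"
  shows "integral\<^sup>L m1 f + integral\<^sup>L m2 f = integral\<^sup>L m3 f + integral\<^sup>L m4 f"
proof -
  obtain B where B: "\<And>x. \<bar>f x\<bar> \<le> B" and fm: "f \<in> borel_measurable borel"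
    using f unfolding Bb_def by blast
  define p where "p x = max (f x) 0" for x
  define n where "n x = max (- f x) 0" for x
  have B0: "0 \<le> B" using B[of undefined] by linarith
  then have pn: "p \<in> Bb" "n \<in> Bb"
    using fm B unfolding p_def n_def Bb_def by (auto simp: abs_le_iff intro!: exI[of _ B])
  have "p \<in> borel_measurable borel" "\<And>x. 0 \<le> p x" "\<exists>B. \<forall>x. p x \<le> B"
    using fm B B0 unfolding p_def by (auto simp: abs_le_iff intro!: exI[of _ B])
  from integral_balance_nonneg[OF m eq this(1,2)] this(3)
  have P: "integral\<^sup>L m1 p + integral\<^sup>L m2 p = integral\<^sup>L m3 p + integral\<^sup>L m4 p" ..
  have "n \<in> borel_measurable borel" "\<And>x. 0 \<le> n x" "\<exists>B. \<forall>x. n x \<le> B"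
    using fm B B0 unfolding n_def by (auto simp: abs_le_iff intro!: exI[of _ B])
  from integral_balance_nonneg[OF m eq this(1,2)] this(3)
  have N: "integral\<^sup>L m1 n + integral\<^sup>L m2 n = integral\<^sup>L m3 n + integral\<^sup>L m4 n" ..
  have "f = (\<lambda>x. p x - n x)" by (auto simp: p_def n_def fun_eq_iff)
  then show ?thesis
    using m pn P N by (simp add: integral_diff finite_borel_measure_Bb_integrable)
qed

lemma signed_integral_jordan_pair:
  assumes "jordan_pair \<sigma> \<mu> \<nu>" "f \<in> Bb"
  shows "signed_integral \<sigma> f = integral\<^sup>L \<mu> f - integral\<^sup>L \<nu> f"
proof -
  let ?P = "\<lambda>v. \<exists>\<mu> \<nu>. finite_measure \<mu> \<and> finite_measure \<nu> \<and>
      sets \<mu> = sets borel \<and> sets \<nu> = sets borel \<and>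
      (\<forall>A\<in>sets borel. \<sigma> A = measure \<mu> A - measure \<nu> A) \<and>
      v = integral\<^sup>L \<mu> f - integral\<^sup>L \<nu> f"
  have "?P (integral\<^sup>L \<mu> f - integral\<^sup>L \<nu> f)"
    using assms(1) unfolding jordan_pair_def finite_borel_measure_def by blast
  then have "?P (SOME v. ?P v)" by (rule someI)
  then obtain \<mu>' \<nu>' where j: "jordan_pair \<sigma> \<mu>' \<nu>'"
    and v: "(SOME v. ?P v) = integral\<^sup>L \<mu>' f - integral\<^sup>L \<nu>' f"
    unfolding jordan_pair_def finite_borel_measure_def by blast
  have "integral\<^sup>L \<mu> f + integral\<^sup>L \<nu>' f = integral\<^sup>L \<mu>' f + integral\<^sup>L \<nu> f"
    using assms j unfolding jordan_pair_def by (intro integral_balance) fastforce+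
  then show ?thesis unfolding signed_integral_def v by simp
qed

definition kernel_repr :: "(('a::topological_space \<Rightarrow> real) \<Rightarrow> 'a \<Rightarrow> real) \<Rightarrow> real \<Rightarrow> bool" where
  "kernel_repr S C \<longleftrightarrow> 0 \<le> C \<and> (\<forall>x. \<exists>\<mu> \<nu>. finite_borel_measure \<mu> \<and> finite_borel_measure \<nu> \<and>
     measure \<mu> UNIV + measure \<nu> UNIV \<le> C \<and> (\<forall>f\<in>Bb. S f x = integral\<^sup>L \<mu> f - integral\<^sup>L \<nu> f))"

lemma kernel_op_imp_kernel_repr:
  assumes "kernel_op S"
  shows "\<exists>C. kernel_repr S C"
proof -
  obtain k where k: "bounded_kernel k" and S: "\<forall>f\<in>Bb. \<forall>x. S f x = signed_integral (k x) f"
    using assms unfolding kernel_op_def by blast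
  obtain C where C: "\<forall>x n (A::nat \<Rightarrow> 'a set). (\<forall>i<n. A i \<in> sets borel) \<and> disjoint_family_on A {..<n}
          \<longrightarrow> (\<Sum>i<n. \<bar>k x (A i)\<bar>) \<le> C" and sm: "\<forall>x. signed_measure (k x)"
    using k unfolding bounded_kernel_def by blast
  have "0 \<le> C"
    using spec[OF spec[OF spec[OF C, of undefined], of 0], of "\<lambda>i. {}"] by (simp add: disjoint_family_on_def)
  moreover have "\<exists>\<mu> \<nu>. finite_borel_measure \<mu> \<and> finite_borel_measure \<nu> \<and>
     measure \<mu> UNIV + measure \<nu> UNIV \<le> C \<and> (\<forall>f\<in>Bb. S f x = integral\<^sup>L \<mu> f - integral\<^sup>L \<nu> f)" for x
  proof -
    obtain \<mu> \<nu> where j: "jordan_pair (k x) \<mu> \<nu>" and m: "measure \<mu> UNIV + measure \<nu> UNIV \<le> C"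
      using signed_measure_Jordan_decomposition[OF sm[rule_format, of x]] C by blast
    then show ?thesis
      using S signed_integral_jordan_pair[OF j] unfolding jordan_pair_def by auto
  qed
  ultimately show ?thesis unfolding kernel_repr_def by blast
qed

lemma kernel_repr_lincomb:
  assumes "kernel_repr S C" "f \<in> Bb" "g \<in> Bb"
  shows "S (\<lambda>y. a * f y + b * g y) x = a * S f x + b * S g x"
proof -
  obtain \<mu> \<nu> where m: "finite_borel_measure \<mu>" "finite_borel_measure \<nu>"
    and S: "\<And>f. f \<in> Bb \<Longrightarrow> S f x = integral\<^sup>L \<mu> f - integral\<^sup>L \<nu> f"
    using assms(1) unfolding kernel_repr_def by blast
  have i: "integrable \<mu> f" "integrable \<mu> g" "integrable \<nu> f" "integrable \<nu> g"
    using assms(2,3) m by (auto intro: finite_borel_measure_Bb_integrable)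
  have "S (\<lambda>y. a * f y + b * g y) x = integral\<^sup>L \<mu> (\<lambda>y. a * f y + b * g y) - integral\<^sup>L \<nu> (\<lambda>y. a * f y + b * g y)"
    using S[OF Bb_lincomb[OF assms(2,3)]] .
  also have "\<dots> = a * (integral\<^sup>L \<mu> f - integral\<^sup>L \<nu> f) + b * (integral\<^sup>L \<mu> g - integral\<^sup>L \<nu> g)"
    using i by (simp add: algebra_simps)
  also have "\<dots> = a * S f x + b * S g x" using S assms(2,3) by simp
  finally show ?thesis .
qed

lemma kernel_repr_scale: "kernel_repr S C \<Longrightarrow> f \<in> Bb \<Longrightarrow> S (\<lambda>y. a * f y) x = a * S f x"
  using kernel_repr_lincomb[of S C f f a 0 x] by simp

lemma kernel_repr_bound:
  assumes "kernel_repr S C" "f \<in> Bb" "\<And>y. \<bar>f y\<bar> \<le> B"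
  shows "\<bar>S f x\<bar> \<le> C * B"
proof -
  obtain \<mu> \<nu> where m: "finite_borel_measure \<mu>" "finite_borel_measure \<nu>"
    and mC: "measure \<mu> UNIV + measure \<nu> UNIV \<le> C"
    and S: "\<And>f. f \<in> Bb \<Longrightarrow> S f x = integral\<^sup>L \<mu> f - integral\<^sup>L \<nu> f"
    using assms(1) unfolding kernel_repr_def by blast
  have fm: "f \<in> borel_measurable borel" using assms(2) unfolding Bb_def by blast
  have B0: "0 \<le> B" using assms(3)[of undefined] by linarith
  have "\<bar>S f x\<bar> \<le> \<bar>integral\<^sup>L \<mu> f\<bar> + \<bar>integral\<^sup>L \<nu> f\<bar>" using S[OF assms(2)] by simp
  also have "\<dots> \<le> B * measure \<mu> UNIV + B * measure \<nu> UNIV"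
    using finite_borel_measure_abs_integral_le[OF _ fm assms(3)] m by (intro add_mono) auto
  also have "\<dots> \<le> C * B" using mC B0 by (simp add: distrib_left[symmetric] mult.commute mult_left_mono)
  finally show ?thesis .
qed

lemma kernel_repr_bounded_convergence:
  assumes "kernel_repr S C" "\<And>n. F n \<in> Bb" "f \<in> Bb" "\<And>n y. \<bar>F n y\<bar> \<le> B" "\<And>y. (\<lambda>n. F n y) \<longlonglongrightarrow> f y"
  shows "(\<lambda>n. S (F n) x) \<longlonglongrightarrow> S f x"
proof -
  obtain \<mu> \<nu> where m: "finite_borel_measure \<mu>" "finite_borel_measure \<nu>"
    and S: "\<And>f. f \<in> Bb \<Longrightarrow> S f x = integral\<^sup>L \<mu> f - integral\<^sup>L \<nu> f"
    using assms(1) unfolding kernel_repr_def by blast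
  have "(\<lambda>n. integral\<^sup>L \<mu> (F n) - integral\<^sup>L \<nu> (F n)) \<longlonglongrightarrow> integral\<^sup>L \<mu> f - integral\<^sup>L \<nu> f"
    using assms(2-5) unfolding Bb_def
    by (intro tendsto_diff finite_borel_measure_bounded_convergence[where B=B] m) auto
  then show ?thesis using S assms(2,3) by simp
qed

lemma kernel_repr_abs_le_opn:
  assumes S: "kernel_repr S C" and f: "f \<in> Bb" "\<And>y. \<bar>f y\<bar> \<le> B"
  shows "\<bar>S f x\<bar> \<le> opn S * B"
proof -
  have B0: "0 \<le> B" using f(2)[of undefined] by linarith
  have unit: "\<bar>S g x\<bar> \<le> opn S" if g: "g \<in> Bb" "\<forall>y. \<bar>g y\<bar> \<le> 1" for g
  proof -
    have bdd: "bdd_above (range (\<lambda>x. \<bar>S g x\<bar>))" if "g \<in> Bb" "\<forall>y. \<bar>g y\<bar> \<le> 1" for g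
      using kernel_repr_bound[OF S that(1), of 1] that(2) by (intro bdd_aboveI[where M=C]) auto
    have "\<bar>S g x\<bar> \<le> (SUP x. \<bar>S g x\<bar>)" using bdd g by (intro cSUP_upper) auto
    also have "\<dots> \<le> opn S" unfolding opn_def
      using g bdd by (intro cSUP_upper) (auto intro!: bdd_aboveI[where M=C] cSUP_least
          simp: kernel_repr_bound[OF S, of _ 1, simplified])
    finally show ?thesis .
  qed
  show ?thesis
  proof (cases "B = 0")
    case True
    then have "f = (\<lambda>y. 0 * f y)" using f(2) by (auto simp: fun_eq_iff)
    then show ?thesis using kernel_repr_scale[OF S f(1), of 0 x] True by (metis mult_zero_left abs_zero order_refl mult_zero_right)
  next
    case False
    then have "0 < B" using B0 by simp
    then have "\<bar>S (\<lambda>y. (1/B) * f y) x\<bar> \<le> opn S"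
      using f by (intro unit Bb_scale) (auto simp: abs_mult)
    moreover have "S (\<lambda>y. (1/B) * f y) x = (1/B) * S f x"
      by (rule kernel_repr_scale[OF S f(1)])
    ultimately have "\<bar>S f x\<bar> / B \<le> opn S" using \<open>0 < B\<close> by (simp add: abs_mult)
    then show ?thesis using \<open>0 < B\<close> by (simp add: field_simps)
  qed
qed

lemma borel_measurable_sections:
  fixes H :: "'a::topological_space \<Rightarrow> 'b::topological_space \<Rightarrow> real"
  assumes "(\<lambda>p. H (fst p) (snd p)) \<in> borel_measurable (borel :: ('a \<times> 'b) measure)"
  shows "H r \<in> borel_measurable borel" "(\<lambda>r. H r y) \<in> borel_measurable borel"
proof -
  have "(\<lambda>y::'b. (r, y)) \<in> borel_measurable borel" "(\<lambda>r::'a. (r, y)) \<in> borel_measurable borel"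
    by (intro borel_measurable_continuous_onI continuous_intros)+
  from measurable_compose[OF this(1) assms] measurable_compose[OF this(2) assms]
  show "H r \<in> borel_measurable borel" "(\<lambda>r. H r y) \<in> borel_measurable borel" by simp_all
qed

lemma finite_borel_measure_integral_swap:
  fixes H :: "real \<Rightarrow> 'a::polish_space \<Rightarrow> real"
  assumes m: "finite_borel_measure m"
    and Hm: "(\<lambda>p. H (fst p) (snd p)) \<in> borel_measurable (borel :: (real \<times> 'a) measure)"
    and Hb: "\<And>r y. \<bar>H r y\<bar> \<le> w r" and wi: "integrable lborel w"
  shows "integral\<^sup>L m (\<lambda>y. integral\<^sup>L lborel (\<lambda>r. H r y)) = integral\<^sup>L lborel (\<lambda>r. integral\<^sup>L m (H r))"
    "integrable lborel (\<lambda>r. integral\<^sup>L m (H r))"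
proof -
  interpret m: finite_measure m using m unfolding finite_borel_measure_def by blast
  interpret P: pair_sigma_finite lborel m
    unfolding pair_sigma_finite_def using lborel.sigma_finite_measure_axioms m.sigma_finite_measure_axioms by blast
  have "sets (lborel \<Otimes>\<^sub>M m) = sets ((borel::real measure) \<Otimes>\<^sub>M (borel::'a measure))"
    using m unfolding finite_borel_measure_def by (intro sets_pair_measure_cong) simp_all
  also have "((borel::real measure) \<Otimes>\<^sub>M (borel::'a measure)) = borel"
    by (rule borel_prod)
  finally have sP: "sets (lborel \<Otimes>\<^sub>M m) = sets (borel :: (real \<times> 'a) measure)" .
  have "(\<lambda>p. H (fst p) (snd p)) \<in> borel_measurable (lborel \<Otimes>\<^sub>M m)"
    using measurable_cong_sets[OF sP refl] Hm by blast
  then have Hm': "case_prod H \<in> borel_measurable (lborel \<Otimes>\<^sub>M m)"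
    by (simp add: case_prod_beta')
  have integ: "integrable (lborel \<Otimes>\<^sub>M m) (case_prod H)"
  proof (rule P.Fubini_integrable[OF Hm'])
    have "integrable m (H r)" for r
      using measurable_Pair2[OF Hm', of r] Hb by (intro m.integrable_const_bound[where B="w r"]) auto
    then show "AE x in lborel. integrable m (\<lambda>y. case_prod H (x, y))"
      by simp
    have "(\<lambda>p. norm (case_prod H p)) \<in> borel_measurable (lborel \<Otimes>\<^sub>M m)" using Hm' by measurable
    then have "(\<lambda>x. LINT y|m. norm (case_prod H (x, y))) \<in> borel_measurable lborel"
      by (intro m.borel_measurable_lebesgue_integral) (simp add: case_prod_beta')
    moreover have "norm (LINT y|m. norm (case_prod H (r, y))) \<le> norm (measure m UNIV * w r)" for r
    proof -
      have "(\<lambda>y. \<bar>H r y\<bar>) \<in> borel_measurable borel"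
        using borel_measurable_sections(1)[OF Hm] by measurable
      then have "\<bar>LINT y|m. \<bar>H r y\<bar>\<bar> \<le> w r * measure m UNIV"
        using finite_borel_measure_abs_integral_le[OF m, of "\<lambda>y. \<bar>H r y\<bar>" "w r"] Hb by simp
      moreover have "0 \<le> w r" using Hb[of r undefined] by linarith
      ultimately show ?thesis by (simp add: mult.commute)
    qed
    ultimately show "integrable lborel (\<lambda>x. LINT y|m. norm (case_prod H (x, y)))"
      by (intro Bochner_Integration.integrable_bound[OF integrable_mult_right[OF wi]]) auto
  qed
  show "integral\<^sup>L m (\<lambda>y. integral\<^sup>L lborel (\<lambda>r. H r y)) = integral\<^sup>L lborel (\<lambda>r. integral\<^sup>L m (H r))"
    using P.Fubini_integral[of H] integ by simp
  show "integrable lborel (\<lambda>r. integral\<^sup>L m (H r))"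
    using P.integrable_fst'[OF integ] by simp
qed

lemma kernel_repr_integral_swap:
  fixes H :: "real \<Rightarrow> 'a::polish_space \<Rightarrow> real"
  assumes S: "kernel_repr S C"
    and Hm: "(\<lambda>p. H (fst p) (snd p)) \<in> borel_measurable (borel :: (real \<times> 'a) measure)"
    and Hb: "\<And>r y. \<bar>H r y\<bar> \<le> w r" and wi: "integrable lborel w"
    and HB: "\<And>r. H r \<in> Bb" and IB: "(\<lambda>y. integral\<^sup>L lborel (\<lambda>r. H r y)) \<in> Bb"
  shows "S (\<lambda>y. integral\<^sup>L lborel (\<lambda>r. H r y)) x = integral\<^sup>L lborel (\<lambda>r. S (H r) x)"
proof -
  obtain \<mu> \<nu> where m: "finite_borel_measure \<mu>" "finite_borel_measure \<nu>"
    and Sx: "\<And>f. f \<in> Bb \<Longrightarrow> S f x = integral\<^sup>L \<mu> f - integral\<^sup>L \<nu> f"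
    using S unfolding kernel_repr_def by blast
  note f1 = finite_borel_measure_integral_swap[OF m(1) Hm Hb wi]
    and f2 = finite_borel_measure_integral_swap[OF m(2) Hm Hb wi]
  have "S (\<lambda>y. integral\<^sup>L lborel (\<lambda>r. H r y)) x
      = integral\<^sup>L lborel (\<lambda>r. integral\<^sup>L \<mu> (H r)) - integral\<^sup>L lborel (\<lambda>r. integral\<^sup>L \<nu> (H r))"
    using Sx[OF IB] f1(1) f2(1) by simp
  also have "\<dots> = integral\<^sup>L lborel (\<lambda>r. integral\<^sup>L \<mu> (H r) - integral\<^sup>L \<nu> (H r))"
    using f1(2) f2(2) by simp
  also have "\<dots> = integral\<^sup>L lborel (\<lambda>r. S (H r) x)"
    using Sx[OF HB] by simp
  finally show ?thesis .
qed

section \<open>Laplace transforms on the half-line\<close>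

lemma lborel_integral_exp_Ici:
  fixes a c :: real
  assumes a: "0 < a"
  shows "integrable lborel (\<lambda>t. indicator {c..} t * exp (- a * t))"
    "integral\<^sup>L lborel (\<lambda>t. indicator {c..} t * exp (- a * t)) = exp (- a * c) / a"
proof -
  have "(\<integral>\<^sup>+x. ennreal (indicator {c..} x * exp (- a * x)) \<partial>lborel) = ennreal (exp (-a*c)/a)"
    using nn_integral_has_integral_lebesgue[OF _ has_integral_exp_minus_to_infinity[OF a]] by simp
  moreover have "(\<lambda>t. indicator {c..} t * exp (- a * t)) \<in> borel_measurable borel" by measurable
  ultimately show "integrable lborel (\<lambda>t. indicator {c..} t * exp (- a * t))"
    "integral\<^sup>L lborel (\<lambda>t. indicator {c..} t * exp (- a * t)) = exp (- a * c) / a"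
    using a by (auto intro!: integrableI_nonneg) (subst integral_eq_nn_integral; auto)
qed

lemma lborel_integral_exp_Ioi:
  fixes a c :: real
  assumes a: "0 < a"
  shows "integrable lborel (\<lambda>t. indicator {c<..} t * exp (- a * t))"
    "integral\<^sup>L lborel (\<lambda>t. indicator {c<..} t * exp (- a * t)) = exp (- a * c) / a"
proof -
  have AE: "AE t in lborel. indicator {c<..} t * exp (- a * t) = indicator {c..} t * exp (- a * t)"
    using AE_lborel_singleton[of c] by eventually_elim (auto simp: indicator_def)
  have m: "(\<lambda>t. indicator {c<..} t * exp (- a * t)) \<in> borel_measurable lborel"
    "(\<lambda>t. indicator {c..} t * exp (- a * t)) \<in> borel_measurable lborel" by simp_all
  show "integrable lborel (\<lambda>t. indicator {c<..} t * exp (- a * t))"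
    using integrable_cong_AE[OF m AE] lborel_integral_exp_Ici(1)[OF a] by simp
  show "integral\<^sup>L lborel (\<lambda>t. indicator {c<..} t * exp (- a * t)) = exp (- a * c) / a"
    using integral_cong_AE[OF m AE] lborel_integral_exp_Ici(2)[OF a] by simp
qed

lemma lborel_integral_swap:
  fixes h :: "real \<Rightarrow> real \<Rightarrow> real"
  assumes hm: "(\<lambda>p. h (fst p) (snd p)) \<in> borel_measurable (borel :: (real \<times> real) measure)"
    and hb: "\<And>s r. \<bar>h s r\<bar> \<le> a s * b r"
    and ai: "integrable lborel a" and bi: "integrable lborel b"
    and a0: "\<And>s. 0 \<le> a s" and b0: "\<And>r. 0 \<le> b r"
  shows "integral\<^sup>L lborel (\<lambda>s. integral\<^sup>L lborel (\<lambda>r. h s r)) = integral\<^sup>L lborel (\<lambda>r. integral\<^sup>L lborel (\<lambda>s. h s r))"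
    "integrable lborel (\<lambda>s. integral\<^sup>L lborel (\<lambda>r. h s r))"
    "integrable lborel (\<lambda>r. integral\<^sup>L lborel (\<lambda>s. h s r))"
proof -
  have "sets (lborel \<Otimes>\<^sub>M lborel) = sets ((borel::real measure) \<Otimes>\<^sub>M (borel::real measure))"
    by (rule sets_pair_measure_cong) simp_all
  also have "((borel::real measure) \<Otimes>\<^sub>M (borel::real measure)) = borel" by (rule borel_prod)
  finally have "(\<lambda>p. h (fst p) (snd p)) \<in> borel_measurable (lborel \<Otimes>\<^sub>M lborel)"
    using measurable_cong_sets hm by blast
  then have hm': "case_prod h \<in> borel_measurable (lborel \<Otimes>\<^sub>M lborel)"
    by (simp add: case_prod_beta')
  have [measurable]: "a \<in> borel_measurable borel" "b \<in> borel_measurable borel"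
    using ai bi by (auto dest: borel_measurable_integrable)
  have "integrable (lborel \<Otimes>\<^sub>M lborel) (\<lambda>p. a (fst p) * b (snd p))"
    using a0 b0 ai bi by (intro lborel_pair.Fubini_integrable) (auto simp: abs_mult)
  then have hi: "integrable (lborel \<Otimes>\<^sub>M lborel) (case_prod h)"
  proof (rule Bochner_Integration.integrable_bound[OF _ hm'])
    show "AE p in lborel \<Otimes>\<^sub>M lborel. norm (case_prod h p) \<le> norm (a (fst p) * b (snd p))"
      using hb a0 b0 by (auto simp: split_beta abs_mult intro: order_trans[OF _ abs_ge_self])
  qed
  show "integral\<^sup>L lborel (\<lambda>s. integral\<^sup>L lborel (\<lambda>r. h s r)) = integral\<^sup>L lborel (\<lambda>r. integral\<^sup>L lborel (\<lambda>s. h s r))"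
    using lborel_pair.Fubini_integral[of h] hi by simp
  show "integrable lborel (\<lambda>s. integral\<^sup>L lborel (\<lambda>r. h s r))"
    using lborel_pair.integrable_fst'[OF hi] by simp
  have "integrable (lborel \<Otimes>\<^sub>M lborel) (\<lambda>p. case_prod h (snd p, fst p))"
    using lborel_pair.integrable_product_swap[OF hi] by (simp add: case_prod_beta')
  from lborel_pair.integrable_fst'[OF this]
  show "integrable lborel (\<lambda>r. integral\<^sup>L lborel (\<lambda>s. h s r))" by simp
qed

lemma lborel_integral_Ioi_shift:
  fixes F :: "real \<Rightarrow> real"
  shows "integral\<^sup>L lborel (\<lambda>r. indicator {0<..} r * (exp (- lam * r) * F (s + r)))
    = exp (lam * s) * integral\<^sup>L lborel (\<lambda>r. indicator {s<..} r * (exp (- lam * r) * F r))"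
proof -
  have "integral\<^sup>L lborel (\<lambda>r. indicator {s<..} r * (exp (- lam * r) * F r))
     = integral\<^sup>L lborel (\<lambda>x. indicator {s<..} (s + 1 * x) * (exp (- lam * (s + 1 * x)) * F (s + 1 * x)))"
    using lborel_integral_real_affine[of 1 "\<lambda>r. indicator {s<..} r * (exp (- lam * r) * F r)" s] by simp
  also have "\<dots> = integral\<^sup>L lborel (\<lambda>x. exp (- lam * s) * (indicator {0<..} x * (exp (- lam * x) * F (s + x))))"
    by (rule Bochner_Integration.integral_cong) (auto simp: indicator_def algebra_simps exp_add[symmetric])
  also have "\<dots> = exp (- lam * s) * integral\<^sup>L lborel (\<lambda>x. indicator {0<..} x * (exp (- lam * x) * F (s + x)))"
    by simp
  finally show ?thesis by (simp add: exp_minus field_simps)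
qed

lemma lborel_integral_exp_Ioc_min:
  fixes lam r t :: real
  assumes "0 < r" "0 < t"
  shows "integral\<^sup>L lborel (\<lambda>s. indicator {0<..t} s * lam * exp (lam * s) * (if s < r then 1 else 0))
    = exp (lam * min r t) - 1"
proof -
  let ?m = "min r t"
  have "AE s in lborel. indicator {0<..t} s * lam * exp (lam * s) * (if s < r then 1 else 0)
      = indicator {0..?m} s * (lam * exp (lam * s))"
    using AE_lborel_singleton[of 0] AE_lborel_singleton[of r]
    by eventually_elim (auto simp: indicator_def)
  then have "integral\<^sup>L lborel (\<lambda>s. indicator {0<..t} s * lam * exp (lam * s) * (if s < r then 1 else 0))
      = integral\<^sup>L lborel (\<lambda>s. indicator {0..?m} s *\<^sub>R (lam * exp (lam * s)))"
    by (intro integral_cong_AE) auto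
  also have "\<dots> = exp (lam * ?m) - exp (lam * 0)"
    using assms
    by (intro integral_FTC_atLeastAtMost)
       (auto intro!: derivative_eq_intros continuous_intros simp flip: has_real_derivative_iff_has_vector_derivative)
  finally show ?thesis by simp
qed

lemma integrable_exp_weighted:
  fixes F :: "real \<Rightarrow> real"
  assumes [measurable]: "F \<in> borel_measurable borel"
    and Fb: "\<And>r. 0 < r \<Longrightarrow> \<bar>F r\<bar> \<le> K * exp (c * r)" and c: "c < lam"
  shows "integrable lborel (\<lambda>r. indicator {0<..} r * (exp (- lam * r) * F r))"
proof (rule Bochner_Integration.integrable_bound)
  show "integrable lborel (\<lambda>r. K * (indicator {0<..} r * exp (- (lam - c) * r)))"
    using lborel_integral_exp_Ioi(1)[of "lam - c" 0] c by simp
  have "\<bar>exp (- lam * r) * F r\<bar> \<le> K * exp (- (lam - c) * r)" if "0 < r" for r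
  proof -
    have "\<bar>exp (- lam * r) * F r\<bar> \<le> exp (- lam * r) * (K * exp (c * r))"
      using Fb[OF that] by (simp add: abs_mult mult_left_mono)
    then show ?thesis by (simp add: algebra_simps exp_add[symmetric])
  qed
  then show "AE r in lborel. norm (indicator {0<..} r * (exp (- lam * r) * F r))
      \<le> norm (K * (indicator {0<..} r * exp (- (lam - c) * r)))"
    by (intro AE_I2) (auto simp: indicator_def intro: order_trans[OF _ abs_ge_self])
qed simp

text \<open>Integration by parts against the tail integral \<open>\<Psi> s = \<integral>\<^sub>s\<^sup>\<infinity> G\<close>, via Fubini:
  \<open>\<integral>\<^sub>0\<^sup>t \<lambda> e\<^sup>\<lambda>\<^sup>s \<Psi> s ds = \<integral>\<^sub>0\<^sup>\<infinity> (e\<^sup>\<lambda>\<^sup>m\<^sup>i\<^sup>n\<^sup>(\<^sup>r\<^sup>,\<^sup>t\<^sup>) - 1) G r dr\<close>.\<close>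
lemma integral_tail_by_parts:
  fixes G :: "real \<Rightarrow> real" and lam t :: real
  assumes Gm[measurable]: "G \<in> borel_measurable borel" and Gi: "integrable lborel G"
    and G0: "\<And>r. r \<le> 0 \<Longrightarrow> G r = 0" and lam: "0 < lam" and t: "0 < t"
  defines "\<Psi> \<equiv> \<lambda>s. integral\<^sup>L lborel (\<lambda>r. indicator {s<..} r * G r)"
  shows "integral\<^sup>L lborel (\<lambda>s. indicator {0<..t} s * lam * exp (lam * s) * \<Psi> s)
      = integral\<^sup>L lborel (\<lambda>r. indicator {0<..t} r * (exp (lam * r) * G r)) + exp (lam * t) * \<Psi> t - \<Psi> 0"
    "integrable lborel (\<lambda>s. indicator {0<..t} s * lam * exp (lam * s) * \<Psi> s)"
proof -
  have \<Psi>i: "integrable lborel (\<lambda>r. indicator {s<..} r * G r)" for s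
    using integrable_mult_indicator[of "{s<..}" lborel G] Gi by simp
  define h where "h s r = indicator {0<..t} s * lam * exp (lam * s) * (if s < r then 1 else 0) * G r" for s r
  define a where "a s = indicator {0..t} s * (lam * exp (lam * t))" for s :: real
  have "(\<lambda>p. h (fst p) (snd p)) \<in> borel_measurable ((borel :: real measure) \<Otimes>\<^sub>M (borel :: real measure))"
    unfolding h_def by measurable
  then have hm: "(\<lambda>p. h (fst p) (snd p)) \<in> borel_measurable (borel :: (real \<times> real) measure)"
    by (simp only: borel_prod)
  have hb: "\<bar>h s r\<bar> \<le> a s * \<bar>G r\<bar>" for s r
  proof -
    have "\<bar>indicator {0<..t} s * lam * exp (lam * s) * (if s < r then 1 else 0)\<bar> \<le> a s"
      using lam by (auto simp: a_def indicator_def)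
    then show ?thesis
      unfolding h_def abs_mult[of _ "G r"] by (rule mult_right_mono) simp
  qed
  have ai: "integrable lborel a"
    unfolding a_def by (intro integrable_mult_left integrable_real_indicator) (auto simp: emeasure_lborel_Icc_eq)
  have a0: "0 \<le> a s" for s using lam by (simp add: a_def)
  note FB = lborel_integral_swap[OF hm hb ai integrable_abs[OF Gi] a0 abs_ge_zero]
  have in_r: "integral\<^sup>L lborel (\<lambda>r. h s r) = indicator {0<..t} s * lam * exp (lam * s) * \<Psi> s" for s
  proof -
    have "integral\<^sup>L lborel (\<lambda>r. h s r)
        = integral\<^sup>L lborel (\<lambda>r. (indicator {0<..t} s * lam * exp (lam * s)) * (indicator {s<..} r * G r))"
      unfolding h_def by (rule Bochner_Integration.integral_cong) (auto simp: indicator_def)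
    then show ?thesis unfolding \<Psi>_def by simp
  qed
  define Q where "Q r = indicator {0<..t} r * (exp (lam * r) * G r) + exp (lam * t) * (indicator {t<..} r * G r)
    - indicator {0<..} r * G r" for r
  have in_s: "integral\<^sup>L lborel (\<lambda>s. h s r) = Q r" for r
  proof (cases "0 < r")
    case True
    have "integral\<^sup>L lborel (\<lambda>s. h s r)
        = integral\<^sup>L lborel (\<lambda>s. indicator {0<..t} s * lam * exp (lam * s) * (if s < r then 1 else 0)) * G r"
      unfolding h_def by simp
    also have "\<dots> = (exp (lam * min r t) - 1) * G r" using lborel_integral_exp_Ioc_min[OF True t] by simp
    also have "\<dots> = Q r" using True by (cases "r \<le> t") (auto simp: Q_def min_def algebra_simps)
    finally show ?thesis .
  qed (simp add: h_def Q_def G0)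
  have "\<bar>indicator {0<..t} r * (exp (lam * r) * G r)\<bar> \<le> exp (lam * t) * \<bar>G r\<bar>" for r
    using lam by (cases "0 < r \<and> r \<le> t") (auto simp: abs_mult indicator_def intro: mult_right_mono)
  then have "integrable lborel (\<lambda>r. indicator {0<..t} r * (exp (lam * r) * G r))"
    by (intro Bochner_Integration.integrable_bound[OF integrable_mult_right[OF integrable_abs[OF Gi],
          of "exp (lam * t)"]]) (auto intro: order_trans[OF _ abs_ge_self])
  then have "integral\<^sup>L lborel Q
      = integral\<^sup>L lborel (\<lambda>r. indicator {0<..t} r * (exp (lam * r) * G r)) + exp (lam * t) * \<Psi> t - \<Psi> 0"
    unfolding Q_def \<Psi>_def using \<Psi>i[of t] \<Psi>i[of 0] by simp
  then show "integral\<^sup>L lborel (\<lambda>s. indicator {0<..t} s * lam * exp (lam * s) * \<Psi> s)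
      = integral\<^sup>L lborel (\<lambda>r. indicator {0<..t} r * (exp (lam * r) * G r)) + exp (lam * t) * \<Psi> t - \<Psi> 0"
    using FB(1) in_r in_s by simp
  show "integrable lborel (\<lambda>s. indicator {0<..t} s * lam * exp (lam * s) * \<Psi> s)"
    using FB(2) in_r by simp
qed

text \<open>For \<open>\<Phi> s = \<integral>\<^sub>0\<^sup>\<infinity> e\<^sup>-\<^sup>\<lambda>\<^sup>r F (s + r) dr\<close> this is the integrated form of \<open>\<Phi>' = \<lambda> \<Phi> - F\<close>.\<close>
lemma laplace_shift_identity:
  fixes F :: "real \<Rightarrow> real" and lam c K t :: real
  assumes Fm[measurable]: "F \<in> borel_measurable borel" and F0: "\<And>r. r \<le> 0 \<Longrightarrow> F r = 0"
    and Fb: "\<And>r. \<bar>F r\<bar> \<le> K * exp (c * r)" and c: "0 \<le> c" "c < lam" and t: "0 < t"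
  defines "\<Phi> \<equiv> \<lambda>s. integral\<^sup>L lborel (\<lambda>r. indicator {0<..} r * (exp (- lam * r) * F (s + r)))"
  shows "\<Phi> t - \<Phi> 0 = integral\<^sup>L lborel (\<lambda>s. indicator {0<..t} s * (lam * \<Phi> s - F s))"
proof -
  have lam: "0 < lam" using c by simp
  have K0: "0 \<le> K" using Fb[of 0] abs_ge_zero[of "F 0"] by simp
  define G where "G r = exp (- lam * r) * F r" for r
  have Gm[measurable]: "G \<in> borel_measurable borel" unfolding G_def by measurable
  have G0: "r \<le> 0 \<Longrightarrow> G r = 0" for r using F0 by (simp add: G_def)
  have "G = (\<lambda>r. indicator {0<..} r * (exp (- lam * r) * F r))"
    using F0 by (auto simp: G_def fun_eq_iff indicator_def)
  then have Gi: "integrable lborel G"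
    using integrable_exp_weighted[OF Fm Fb c(2)] by simp
  define \<Psi> where "\<Psi> s = integral\<^sup>L lborel (\<lambda>r. indicator {s<..} r * G r)" for s
  have \<Phi>\<Psi>: "\<Phi> s = exp (lam * s) * \<Psi> s" for s
    unfolding \<Phi>_def \<Psi>_def G_def by (rule lborel_integral_Ioi_shift)
  have eG: "indicator {0<..t} r * (exp (lam * r) * G r) = indicator {0<..t} r * F r" for r
    by (simp add: G_def exp_minus field_simps)
  note parts = integral_tail_by_parts[OF Gm Gi G0 lam t, folded \<Psi>_def, unfolded eG]
  have iF: "integrable lborel (\<lambda>r. indicator {0<..t} r * F r)"
  proof (rule Bochner_Integration.integrable_bound)
    show "integrable lborel (\<lambda>r. indicator {0..t} r * (K * exp (c * t)))"
      by (intro integrable_mult_left integrable_real_indicator) (auto simp: emeasure_lborel_Icc_eq)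
    have "\<bar>F r\<bar> \<le> K * exp (c * t)" if "r \<le> t" for r
    proof -
      have "c * r \<le> c * t" using that c(1) by (rule mult_left_mono)
      then have "K * exp (c * r) \<le> K * exp (c * t)" using K0 by (intro mult_left_mono) auto
      then show ?thesis using Fb[of r] by linarith
    qed
    then show "AE r in lborel. norm (indicator {0<..t} r * F r) \<le> norm (indicator {0..t} r * (K * exp (c * t)))"
      using K0 by (auto simp: indicator_def)
  qed simp
  have "integral\<^sup>L lborel (\<lambda>s. indicator {0<..t} s * (lam * \<Phi> s - F s))
      = integral\<^sup>L lborel (\<lambda>s. indicator {0<..t} s * lam * exp (lam * s) * \<Psi> s - indicator {0<..t} s * F s)"
    by (simp add: \<Phi>\<Psi> algebra_simps)
  also have "\<dots> = integral\<^sup>L lborel (\<lambda>s. indicator {0<..t} s * lam * exp (lam * s) * \<Psi> s)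
      - integral\<^sup>L lborel (\<lambda>s. indicator {0<..t} s * F s)"
    using parts(2) iF by (rule Bochner_Integration.integral_diff)
  finally show ?thesis using parts(1) \<Phi>\<Psi>[of t] \<Phi>\<Psi>[of 0] by simp
qed

lemma exp_weight_split:
  fixes c \<epsilon> lam s t :: real
  assumes "0 < s" "s \<le> t" "0 \<le> c" "0 < \<epsilon>"
  shows "exp (- lam * t) * exp (c * s) \<le> exp (- (lam - c - \<epsilon>) * t) * exp (- \<epsilon> * s)"
proof -
  have "(c + \<epsilon>) * s \<le> (c + \<epsilon>) * t" using assms by (intro mult_left_mono) auto
  then have "- lam * t + c * s \<le> - (lam - c - \<epsilon>) * t + - \<epsilon> * s" by (simp add: algebra_simps)
  then show ?thesis by (simp only: exp_add[symmetric] exp_le_cancel_iff)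
qed

lemma laplace_integral_Ioc:
  fixes G :: "real \<Rightarrow> real" and lam c K :: real
  assumes Gm[measurable]: "G \<in> borel_measurable borel"
    and Gb: "\<And>s. 0 < s \<Longrightarrow> \<bar>G s\<bar> \<le> K * exp (c * s)" and c: "0 \<le> c" "c < lam"
  defines "I \<equiv> \<lambda>t. indicator {0<..} t * (exp (- lam * t) * integral\<^sup>L lborel (\<lambda>s. indicator {0<..t} s * G s))"
  shows "integrable lborel I"
    "integral\<^sup>L lborel I = integral\<^sup>L lborel (\<lambda>s. indicator {0<..} s * (exp (- lam * s) * G s)) / lam"
proof -
  have lam0: "0 < lam" using c by simp
  have "0 \<le> K * exp (c * 1)" using Gb[of 1] abs_ge_zero[of "G 1"] by linarith
  then have K0: "0 \<le> K" by (simp add: zero_le_mult_iff)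
  define \<epsilon> where "\<epsilon> = (lam - c) / 2"
  have \<epsilon>: "0 < \<epsilon>" "0 < lam - c - \<epsilon>" using c by (auto simp: \<epsilon>_def)
  define h where "h t s = indicator {0<..} t * exp (- lam * t) * (indicator {0<..} s * (if s \<le> t then 1 else 0) * G s)"
    for t s
  define a where "a t = K * (indicator {0<..} t * exp (- (lam - c - \<epsilon>) * t))" for t
  define b where "b s = indicator {0<..} s * exp (- \<epsilon> * s)" for s :: real
  have "(\<lambda>p. h (fst p) (snd p)) \<in> borel_measurable ((borel :: real measure) \<Otimes>\<^sub>M (borel :: real measure))"
    unfolding h_def by measurable
  then have hm: "(\<lambda>p. h (fst p) (snd p)) \<in> borel_measurable (borel :: (real \<times> real) measure)"
    by (simp only: borel_prod)
  have hb: "\<bar>h t s\<bar> \<le> a t * b s" for t s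
  proof (cases "0 < s \<and> s \<le> t")
    case True
    have "\<bar>h t s\<bar> \<le> exp (- lam * t) * (K * exp (c * s))"
      using True Gb[of s] by (simp add: h_def abs_mult mult_left_mono)
    also have "\<dots> \<le> K * (exp (- (lam - c - \<epsilon>) * t) * exp (- \<epsilon> * s))"
      using exp_weight_split[of s t c \<epsilon> lam] True c(1) \<epsilon>(1) K0
      by (simp add: mult.left_commute mult_left_mono)
    also have "\<dots> = a t * b s" using True by (simp add: a_def b_def)
    finally show ?thesis .
  next
    case False
    then show ?thesis using K0 by (auto simp: h_def a_def b_def indicator_def)
  qed
  have ai: "integrable lborel a" unfolding a_def using lborel_integral_exp_Ioi(1)[of "lam - c - \<epsilon>" 0] \<epsilon> by simp
  have bi: "integrable lborel b" unfolding b_def using lborel_integral_exp_Ioi(1)[of \<epsilon> 0] \<epsilon> by simp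
  have a0: "0 \<le> a t" for t using K0 by (simp add: a_def)
  have b0: "0 \<le> b s" for s by (simp add: b_def)
  note FB = lborel_integral_swap[OF hm hb ai bi a0 b0]
  have in_s: "integral\<^sup>L lborel (\<lambda>s. h t s) = I t" for t
  proof (cases "0 < t")
    case True
    have "integral\<^sup>L lborel (\<lambda>s. h t s)
        = indicator {0<..} t * exp (- lam * t) * integral\<^sup>L lborel (\<lambda>s. indicator {0<..t} s * G s)"
      unfolding h_def by (subst integral_mult_right_zero[symmetric])
        (rule Bochner_Integration.integral_cong, auto simp: indicator_def)
    then show ?thesis by (simp add: I_def)
  qed (simp add: h_def I_def)
  have in_t: "integral\<^sup>L lborel (\<lambda>t. h t s) = indicator {0<..} s * (exp (- lam * s) * G s) / lam" for s
  proof (cases "0 < s")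
    case True
    have "integral\<^sup>L lborel (\<lambda>t. h t s) = integral\<^sup>L lborel (\<lambda>t. indicator {s..} t * exp (- lam * t)) * G s"
      unfolding h_def using True
      by (subst integral_mult_left_zero[symmetric]) (rule Bochner_Integration.integral_cong, auto simp: indicator_def)
    then show ?thesis using True lborel_integral_exp_Ici(2)[OF lam0, of s] by simp
  qed (simp add: h_def)
  show "integrable lborel I" using FB(2) in_s by simp
  show "integral\<^sup>L lborel I = integral\<^sup>L lborel (\<lambda>s. indicator {0<..} s * (exp (- lam * s) * G s)) / lam"
    using FB(1) in_s in_t by simp
qed

lemma laplace_of_antiderivative:
  fixes W G :: "real \<Rightarrow> real" and w0 lam c K :: real
  assumes Gm: "G \<in> borel_measurable borel"
    and Gb: "\<And>s. 0 < s \<Longrightarrow> \<bar>G s\<bar> \<le> K * exp (c * s)" and c: "0 \<le> c" "c < lam"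
    and eq: "\<And>t. 0 < t \<Longrightarrow> W t - w0 = integral\<^sup>L lborel (\<lambda>s. indicator {0<..t} s * G s)"
  shows "lam * integral\<^sup>L lborel (\<lambda>t. indicator {0<..} t * (exp (- lam * t) * W t))
    = w0 + integral\<^sup>L lborel (\<lambda>s. indicator {0<..} s * (exp (- lam * s) * G s))"
proof -
  have lam0: "0 < lam" using c by simp
  have "indicator {0<..} t * (exp (- lam * t) * (W t - w0))
      = indicator {0<..} t * (exp (- lam * t) * integral\<^sup>L lborel (\<lambda>s. indicator {0<..t} s * G s))" for t
    using eq[of t] by (cases "0 < t") simp_all
  note I = laplace_integral_Ioc[OF Gm Gb c, folded this]
  have iE: "integrable lborel (\<lambda>t. w0 * (indicator {0<..} t * exp (- lam * t)))"
    using lborel_integral_exp_Ioi(1)[OF lam0, of 0] by simp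
  have "integral\<^sup>L lborel (\<lambda>t. indicator {0<..} t * (exp (- lam * t) * W t))
     = integral\<^sup>L lborel (\<lambda>t. indicator {0<..} t * (exp (- lam * t) * (W t - w0))
        + w0 * (indicator {0<..} t * exp (- lam * t)))"
    by (rule Bochner_Integration.integral_cong) (auto simp: algebra_simps)
  also have "\<dots> = integral\<^sup>L lborel (\<lambda>s. indicator {0<..} s * (exp (- lam * s) * G s)) / lam + w0 / lam"
    using I iE lborel_integral_exp_Ioi(2)[OF lam0, of 0] by simp
  finally show ?thesis using lam0 by (simp add: field_simps)
qed

section \<open>The Laplace transform of a strong Feller semigroup\<close>

locale strong_feller_semigroup =
  fixes T :: "real \<Rightarrow> ('a::polish_space \<Rightarrow> real) \<Rightarrow> ('a \<Rightarrow> real)" and M \<omega> :: real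
  assumes kernel_semigroup: "kernel_semigroup T M \<omega>"
    and strong_feller: "\<forall>t>0. strong_feller (T t)"
begin

lemma T_kernel_repr: "0 < t \<Longrightarrow> \<exists>C. kernel_repr (T t) C"
  using kernel_semigroup kernel_op_imp_kernel_repr unfolding kernel_semigroup_def by blast

lemma T_continuous: "0 < t \<Longrightarrow> f \<in> Bb \<Longrightarrow> continuous_on UNIV (T t f)"
  using strong_feller unfolding strong_feller_def Cb_def by blast

lemma T_Bb: "0 < t \<Longrightarrow> f \<in> Bb \<Longrightarrow> T t f \<in> Bb"
  using strong_feller unfolding strong_feller_def Cb_def Bb_def by (auto intro: borel_measurable_continuous_onI)

lemma T_bound:
  assumes "0 < t" "f \<in> Bb" "\<And>y. \<bar>f y\<bar> \<le> B"
  shows "\<bar>T t f x\<bar> \<le> M * exp (\<omega> * t) * B"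
proof -
  obtain C where C: "kernel_repr (T t) C" using T_kernel_repr[OF assms(1)] by blast
  have B0: "0 \<le> B" using assms(3)[of undefined] by linarith
  have "\<bar>T t f x\<bar> \<le> opn (T t) * B" by (rule kernel_repr_abs_le_opn[OF C assms(2,3)])
  also have "\<dots> \<le> M * exp (\<omega> * t) * B"
    using kernel_semigroup assms(1) B0 unfolding kernel_semigroup_def by (intro mult_right_mono) auto
  finally show ?thesis .
qed

lemma M_nonneg: "0 \<le> M"
proof -
  have "\<bar>T 1 (\<lambda>y. 1) undefined\<bar> \<le> M * exp (\<omega> * 1) * 1" by (rule T_bound) (auto intro: Bb_const)
  then have "0 \<le> M * exp \<omega>" using abs_ge_zero[of "T 1 (\<lambda>y. 1) undefined"] by simp
  then show ?thesis by (simp add: zero_le_mult_iff)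
qed

lemma T_lincomb: "0 < t \<Longrightarrow> f \<in> Bb \<Longrightarrow> g \<in> Bb \<Longrightarrow> T t (\<lambda>y. a * f y + b * g y) x = a * T t f x + b * T t g x"
  using T_kernel_repr kernel_repr_lincomb by blast

lemma T_scale: "0 < t \<Longrightarrow> f \<in> Bb \<Longrightarrow> T t (\<lambda>y. a * f y) x = a * T t f x"
  using T_kernel_repr kernel_repr_scale by blast

lemma T_bounded_convergence:
  "0 < t \<Longrightarrow> (\<And>n. F n \<in> Bb) \<Longrightarrow> f \<in> Bb \<Longrightarrow> (\<And>n y. \<bar>F n y\<bar> \<le> B) \<Longrightarrow>
   (\<And>y. (\<lambda>n. F n y) \<longlonglongrightarrow> f y) \<Longrightarrow> (\<lambda>n. T t (F n) x) \<longlonglongrightarrow> T t f x"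
  using T_kernel_repr kernel_repr_bounded_convergence by metis

lemma T_add: "0 < t \<Longrightarrow> 0 < s \<Longrightarrow> f \<in> Bb \<Longrightarrow> T (t + s) f = T t (T s f)"
  using kernel_semigroup unfolding kernel_semigroup_def by blast

text \<open>\<open>T 0\<close> is not part of the semigroup, so the orbit is extended by \<open>0\<close> to \<open>t \<le> 0\<close>.\<close>
lemma T_orbit_measurable:
  assumes "f \<in> Bb"
  shows "(\<lambda>p. if 0 < fst p then T (fst p) f (snd p) else 0) \<in> borel_measurable (borel :: (real \<times> 'a) measure)"
proof -
  have "(\<lambda>(t, x). T t f x) \<in> borel_measurable (restrict_space borel ({0<..} \<times> UNIV))"
    using kernel_semigroup assms unfolding kernel_semigroup_def by blast
  moreover have "({0<..} \<times> UNIV) \<inter> space borel \<in> sets (borel :: (real \<times> 'a) measure)"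
    by (auto intro!: borel_open open_Times)
  ultimately have "(\<lambda>p. if p \<in> {0<..} \<times> UNIV then (\<lambda>(t, x). T t f x) p else 0) \<in> borel_measurable borel"
    using measurable_restrict_space_iff[of "{0<..} \<times> UNIV" borel 0 borel "\<lambda>(t, x). T t f x"] by auto
  moreover have "(\<lambda>p. if p \<in> {0<..} \<times> UNIV then (\<lambda>(t, x). T t f x) p else 0)
      = (\<lambda>p. if 0 < fst p then T (fst p) f (snd p) else 0)"
    by (auto simp: fun_eq_iff split: prod.splits)
  ultimately show ?thesis by simp
qed

lemma T_orbit_measurable_time:
  "f \<in> Bb \<Longrightarrow> (\<lambda>t. if 0 < t then T t f x else 0) \<in> borel_measurable borel"
  using borel_measurable_sections(2)[OF T_orbit_measurable] by simp

lemma T_orbit_bound: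
  assumes "f \<in> Bb" "\<And>y. \<bar>f y\<bar> \<le> B"
  shows "\<bar>(if 0 < r then T r f x else 0)\<bar> \<le> (M * B) * exp (max \<omega> 0 * r)"
proof -
  have MB: "0 \<le> M * B" using M_nonneg assms(2)[of undefined] by simp
  show ?thesis
  proof (cases "0 < r")
    case True
    have "\<omega> * r \<le> max \<omega> 0 * r" using True by (intro mult_right_mono) auto
    then have "(M * B) * exp (\<omega> * r) \<le> (M * B) * exp (max \<omega> 0 * r)"
      using MB by (intro mult_left_mono) auto
    moreover have "\<bar>T r f x\<bar> \<le> (M * B) * exp (\<omega> * r)"
      using T_bound[OF True assms, of x] by (simp add: ac_simps)
    ultimately show ?thesis using True by simp
  qed (use MB in simp)
qed

lemma laplace_eq: "laplace T lam f x = integral\<^sup>L lborel (\<lambda>t. indicator {0<..} t * (exp (- lam * t) * T t f x))"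
  unfolding laplace_def set_lebesgue_integral_def by simp

lemma laplace_integrand_measurable:
  assumes "f \<in> Bb"
  shows "(\<lambda>t. indicator {0<..} t * (exp (- lam * t) * T t f x)) \<in> borel_measurable borel"
proof -
  have "(\<lambda>t. exp (- lam * t) * (if 0 < t then T t f x else 0)) \<in> borel_measurable borel"
    using T_orbit_measurable_time[OF assms] by measurable
  moreover have "(\<lambda>t. exp (- lam * t) * (if 0 < t then T t f x else 0))
      = (\<lambda>t. indicator {0<..} t * (exp (- lam * t) * T t f x))"
    by (auto simp: fun_eq_iff indicator_def)
  ultimately show ?thesis by simp
qed

lemma laplace_integrand_bound:
  assumes "f \<in> Bb" "\<And>y. \<bar>f y\<bar> \<le> B"
  shows "\<bar>indicator {0<..} t * (exp (- lam * t) * T t f x)\<bar> \<le> M * B * (indicator {0<..} t * exp (- (lam - \<omega>) * t))"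
proof (cases "0 < t")
  case True
  have "exp (- lam * t) * \<bar>T t f x\<bar> \<le> exp (- lam * t) * (M * exp (\<omega> * t) * B)"
    using T_bound[OF True assms] by (intro mult_left_mono) auto
  also have "\<dots> = M * B * exp (- (lam - \<omega>) * t)" by (simp add: algebra_simps exp_add[symmetric])
  finally show ?thesis using True by (simp add: abs_mult)
qed simp

lemma laplace_dominant_integrable:
  "\<omega> < lam \<Longrightarrow> integrable lborel (\<lambda>t. c * (indicator {0<..} t * exp (- (lam - \<omega>) * t)))"
  using lborel_integral_exp_Ioi(1)[of "lam - \<omega>" 0] by (intro integrable_mult_right) auto

lemma laplace_integrable:
  assumes "\<omega> < lam" "f \<in> Bb"
  shows "integrable lborel (\<lambda>t. indicator {0<..} t * (exp (- lam * t) * T t f x))"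
proof -
  obtain B where B: "\<And>y. \<bar>f y\<bar> \<le> B" using assms unfolding Bb_def by blast
  show ?thesis
  proof (rule Bochner_Integration.integrable_bound[OF laplace_dominant_integrable[OF assms(1), of "M * B"]])
    show "(\<lambda>t. indicator {0<..} t * (exp (- lam * t) * T t f x)) \<in> borel_measurable lborel"
      using laplace_integrand_measurable[OF assms(2)] by simp
    show "AE t in lborel. norm (indicator {0<..} t * (exp (- lam * t) * T t f x))
        \<le> norm (M * B * (indicator {0<..} t * exp (- (lam - \<omega>) * t)))"
      unfolding real_norm_def by (intro AE_I2 order_trans[OF laplace_integrand_bound[OF assms(2) B] abs_ge_self])
  qed
qed

lemma laplace_bound:
  assumes "\<omega> < lam" "f \<in> Bb" "\<And>y. \<bar>f y\<bar> \<le> B"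
  shows "\<bar>laplace T lam f x\<bar> \<le> M * B / (lam - \<omega>)"
proof -
  have "\<bar>laplace T lam f x\<bar> \<le> integral\<^sup>L lborel (\<lambda>t. \<bar>indicator {0<..} t * (exp (- lam * t) * T t f x)\<bar>)"
    unfolding laplace_eq by (rule integral_abs_bound)
  also have "\<dots> \<le> integral\<^sup>L lborel (\<lambda>t. M * B * (indicator {0<..} t * exp (- (lam - \<omega>) * t)))"
    using laplace_integrable[OF assms(1,2)] laplace_dominant_integrable[OF assms(1)]
      laplace_integrand_bound[OF assms(2,3)] by (intro integral_mono) auto
  also have "\<dots> = M * B / (lam - \<omega>)"
    using lborel_integral_exp_Ioi(2)[of "lam - \<omega>" 0] assms(1) by simp
  finally show ?thesis .
qed

lemma laplace_lincomb:
  assumes "\<omega> < lam" "f \<in> Bb" "g \<in> Bb"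
  shows "laplace T lam (\<lambda>y. a * f y + b * g y) x = a * laplace T lam f x + b * laplace T lam g x"
proof -
  have "laplace T lam (\<lambda>y. a * f y + b * g y) x
      = integral\<^sup>L lborel (\<lambda>t. a * (indicator {0<..} t * (exp (- lam * t) * T t f x))
          + b * (indicator {0<..} t * (exp (- lam * t) * T t g x)))"
    unfolding laplace_eq
    by (rule Bochner_Integration.integral_cong[OF refl])
       (use T_lincomb[OF _ assms(2,3)] in \<open>auto simp: indicator_def algebra_simps\<close>)
  also have "\<dots> = a * laplace T lam f x + b * laplace T lam g x"
    unfolding laplace_eq using laplace_integrable[OF assms(1,2)] laplace_integrable[OF assms(1,3)] by simp
  finally show ?thesis .
qed

lemma laplace_diff:
  "\<omega> < lam \<Longrightarrow> f \<in> Bb \<Longrightarrow> g \<in> Bb \<Longrightarrow> laplace T lam (\<lambda>y. f y - g y) x = laplace T lam f x - laplace T lam g x"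
  using laplace_lincomb[of lam f g 1 "-1" x] by simp

lemma laplace_bounded_convergence:
  assumes lam: "\<omega> < lam" and F: "\<And>n. F n \<in> Bb" and f: "f \<in> Bb"
    and b: "\<And>n y. \<bar>F n y\<bar> \<le> B" and l: "\<And>y. (\<lambda>n. F n y) \<longlonglongrightarrow> f y"
  shows "(\<lambda>n. laplace T lam (F n) x) \<longlonglongrightarrow> laplace T lam f x"
  unfolding laplace_eq
proof (rule integral_dominated_convergence[OF _ _ laplace_dominant_integrable[OF lam, of "M * B"]])
  show "AE t in lborel. (\<lambda>n. indicator {0<..} t * (exp (- lam * t) * T t (F n) x))
      \<longlonglongrightarrow> indicator {0<..} t * (exp (- lam * t) * T t f x)"
  proof (rule AE_I2)
    fix t :: real
    show "(\<lambda>n. indicator {0<..} t * (exp (- lam * t) * T t (F n) x))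
      \<longlonglongrightarrow> indicator {0<..} t * (exp (- lam * t) * T t f x)"
      using T_bounded_convergence[OF _ F f b l] by (cases "0 < t") (auto intro: tendsto_mult_left)
  qed
qed (use laplace_integrand_measurable[OF f] laplace_integrand_measurable[OF F]
      laplace_integrand_bound[OF F b] in auto)

lemma laplace_continuous:
  assumes lam: "\<omega> < lam" and f: "f \<in> Bb"
  shows "continuous_on UNIV (laplace T lam f)"
proof (rule continuous_on_sequentiallyI)
  fix u a assume u: "u \<longlonglongrightarrow> (a::'a)"
  obtain B where B: "\<And>y. \<bar>f y\<bar> \<le> B" using f unfolding Bb_def by blast
  have "(\<lambda>n. T t f (u n)) \<longlonglongrightarrow> T t f a" if "0 < t" for t
    using continuous_on_tendsto_compose[OF T_continuous[OF that f] u] by simp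
  then have "(\<lambda>n. indicator {0<..} t * (exp (- lam * t) * T t f (u n)))
      \<longlonglongrightarrow> indicator {0<..} t * (exp (- lam * t) * T t f a)" for t
    by (cases "0 < t") (auto intro: tendsto_mult_left)
  then have "AE t in lborel. (\<lambda>n. indicator {0<..} t * (exp (- lam * t) * T t f (u n)))
      \<longlonglongrightarrow> indicator {0<..} t * (exp (- lam * t) * T t f a)"
    by simp
  then show "(\<lambda>n. laplace T lam f (u n)) \<longlonglongrightarrow> laplace T lam f a"
    unfolding laplace_eq
    using laplace_integrand_measurable[OF f] laplace_integrand_bound[OF f B]
    by (intro integral_dominated_convergence[OF _ _ laplace_dominant_integrable[OF lam, of "M * B"]]) auto
qed

lemma laplace_Bb:
  assumes "\<omega> < lam" "f \<in> Bb"
  shows "laplace T lam f \<in> Bb"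
proof -
  obtain B where B: "\<And>y. \<bar>f y\<bar> \<le> B" using assms unfolding Bb_def by blast
  show ?thesis unfolding Bb_def
    using laplace_bound[OF assms B] borel_measurable_continuous_onI[OF laplace_continuous[OF assms]] by blast
qed

text \<open>The kernel of \<open>T s\<close> commutes with the time integral (Fubini).\<close>
lemma T_laplace:
  assumes lam: "\<omega> < lam" and s: "0 < s" and f: "f \<in> Bb"
  shows "T s (laplace T lam f) x
    = integral\<^sup>L lborel (\<lambda>r. indicator {0<..} r * (exp (- lam * r) * (if 0 < s + r then T (s + r) f x else 0)))"
proof -
  obtain C where C: "kernel_repr (T s) C" using T_kernel_repr[OF s] by blast
  obtain B where B: "\<And>y. \<bar>f y\<bar> \<le> B" using f unfolding Bb_def by blast
  define H where "H r = (\<lambda>y. indicator {0<..} r * (exp (- lam * r) * T r f y))" for r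
  have "(\<lambda>p::real \<times> 'a. exp (- lam * fst p)) \<in> borel_measurable borel"
    by (intro borel_measurable_continuous_onI continuous_intros)
  then have "(\<lambda>p. exp (- lam * fst p) * (if 0 < fst p then T (fst p) f (snd p) else 0))
      \<in> borel_measurable (borel :: (real \<times> 'a) measure)"
    using T_orbit_measurable[OF f] by (rule borel_measurable_times)
  moreover have "(\<lambda>p. exp (- lam * fst p) * (if 0 < fst p then T (fst p) f (snd p) else 0))
      = (\<lambda>p. H (fst p) (snd p))"
    by (auto simp: fun_eq_iff H_def indicator_def)
  ultimately have Hm: "(\<lambda>p. H (fst p) (snd p)) \<in> borel_measurable (borel :: (real \<times> 'a) measure)"
    by simp
  have HB: "H r \<in> Bb" for r
    using Bb_scale[OF T_Bb[OF _ f]] Bb_const[of 0] by (cases "0 < r") (auto simp: H_def)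
  have RH: "(\<lambda>y. integral\<^sup>L lborel (\<lambda>r. H r y)) = laplace T lam f"
    by (auto simp: fun_eq_iff H_def laplace_eq)
  have "T s (\<lambda>y. integral\<^sup>L lborel (\<lambda>r. H r y)) x = integral\<^sup>L lborel (\<lambda>r. T s (H r) x)"
  proof (rule kernel_repr_integral_swap[OF C Hm _ laplace_dominant_integrable[OF lam] HB])
    show "\<bar>H r y\<bar> \<le> M * B * (indicator {0<..} r * exp (- (lam - \<omega>) * r))" for r y
      using laplace_integrand_bound[OF f B] by (simp add: H_def)
    show "(\<lambda>y. integral\<^sup>L lborel (\<lambda>r. H r y)) \<in> Bb"
      unfolding RH by (rule laplace_Bb[OF lam f])
  qed
  also have "\<dots> = integral\<^sup>L lborel
      (\<lambda>r. indicator {0<..} r * (exp (- lam * r) * (if 0 < s + r then T (s + r) f x else 0)))"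
  proof (rule Bochner_Integration.integral_cong[OF refl])
    fix r :: real
    show "T s (H r) x = indicator {0<..} r * (exp (- lam * r) * (if 0 < s + r then T (s + r) f x else 0))"
    proof (cases "0 < r")
      case True
      then have "T s (H r) x = exp (- lam * r) * T s (T r f) x"
        using T_scale[OF s T_Bb[OF True f]] by (simp add: H_def)
      then show ?thesis using T_add[OF s True f] True s by simp
    next
      case False
      then have "H r = (\<lambda>y. 0 * f y)" by (auto simp: H_def fun_eq_iff)
      then show ?thesis using T_scale[OF s f, of 0 x] False by simp
    qed
  qed
  finally show ?thesis unfolding RH .
qed

lemma laplace_in_full_gen:
  assumes f: "f \<in> Bb" and lam: "max \<omega> 0 < lam"
  shows "(laplace T lam f, \<lambda>y. lam * laplace T lam f y - f y) \<in> full_gen T"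
  unfolding full_gen_def
proof (intro CollectI case_prodI conjI allI impI)
  have lam': "\<omega> < lam" using lam by simp
  show Rf: "laplace T lam f \<in> Bb" by (rule laplace_Bb[OF lam' f])
  show "(\<lambda>y. lam * laplace T lam f y - f y) \<in> Bb" using Bb_lincomb[OF Rf f, of lam "-1"] by simp
  fix t :: real and x :: 'a assume t: "0 < t"
  obtain B where B: "\<And>y. \<bar>f y\<bar> \<le> B" using f unfolding Bb_def by blast
  define F where "F r = (if 0 < r then T r f x else 0)" for r
  define \<Phi> where "\<Phi> s = integral\<^sup>L lborel (\<lambda>r. indicator {0<..} r * (exp (- lam * r) * F (s + r)))" for s
  have "\<Phi> t - \<Phi> 0 = integral\<^sup>L lborel (\<lambda>s. indicator {0<..t} s * (lam * \<Phi> s - F s))"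
    unfolding \<Phi>_def F_def using lam t
    by (intro laplace_shift_identity[where c="max \<omega> 0" and K="M * B"] T_orbit_measurable_time[OF f]
        T_orbit_bound[OF f B]) auto
  moreover have T\<Phi>: "T s (laplace T lam f) x = \<Phi> s" if "0 < s" for s
    unfolding \<Phi>_def F_def using T_laplace[OF lam' that f] by simp
  moreover have "\<Phi> 0 = laplace T lam f x"
    unfolding \<Phi>_def laplace_eq by (rule Bochner_Integration.integral_cong) (auto simp: F_def indicator_def)
  moreover have "(LINT s:{0<..t}|lborel. T s (\<lambda>y. lam * laplace T lam f y - f y) x)
      = integral\<^sup>L lborel (\<lambda>s. indicator {0<..t} s * (lam * \<Phi> s - F s))"
    unfolding set_lebesgue_integral_def
    using T_lincomb[OF _ Rf f, of _ lam "-1"] T\<Phi>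
    by (intro Bochner_Integration.integral_cong) (auto simp: F_def indicator_def)
  ultimately show "T t (laplace T lam f) x - laplace T lam f x
      = (LINT s:{0<..t}|lborel. T s (\<lambda>y. lam * laplace T lam f y - f y) x)"
    using t by simp
qed

lemma full_gen_eq_laplace:
  assumes wg: "(w, g) \<in> full_gen T" and lam: "max \<omega> 0 < lam"
  shows "w = laplace T lam (\<lambda>y. lam * w y - g y)"
proof
  fix x
  have w: "w \<in> Bb" and g: "g \<in> Bb"
    and eqf: "\<And>t. 0 < t \<Longrightarrow> T t w x - w x = (LINT s:{0<..t}|lborel. T s g x)"
    using wg unfolding full_gen_def by auto
  obtain B where B: "\<And>y. \<bar>g y\<bar> \<le> B" using g unfolding Bb_def by blast
  define W where "W t = (if 0 < t then T t w x else 0)" for t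
  define G where "G s = (if 0 < s then T s g x else 0)" for s
  have "W t - w x = integral\<^sup>L lborel (\<lambda>s. indicator {0<..t} s * G s)" if t: "0 < t" for t
    using eqf[OF t] t unfolding set_lebesgue_integral_def
    by (simp add: W_def) (rule Bochner_Integration.integral_cong; auto simp: G_def indicator_def)
  moreover have "G \<in> borel_measurable borel"
    unfolding G_def using T_orbit_measurable_time g by blast
  moreover have "\<bar>G s\<bar> \<le> M * B * exp (max \<omega> 0 * s)" for s
    unfolding G_def by (rule T_orbit_bound[OF g B])
  ultimately have "lam * integral\<^sup>L lborel (\<lambda>t. indicator {0<..} t * (exp (- lam * t) * W t))
      = w x + integral\<^sup>L lborel (\<lambda>s. indicator {0<..} s * (exp (- lam * s) * G s))"
    using lam by (intro laplace_of_antiderivative[where c="max \<omega> 0" and K="M * B"]) auto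
  moreover have "integral\<^sup>L lborel (\<lambda>t. indicator {0<..} t * (exp (- lam * t) * W t)) = laplace T lam w x"
    unfolding laplace_eq by (rule Bochner_Integration.integral_cong) (auto simp: W_def indicator_def)
  moreover have "integral\<^sup>L lborel (\<lambda>s. indicator {0<..} s * (exp (- lam * s) * G s)) = laplace T lam g x"
    unfolding laplace_eq by (rule Bochner_Integration.integral_cong) (auto simp: G_def indicator_def)
  moreover have "laplace T lam (\<lambda>y. lam * w y - g y) x = lam * laplace T lam w x - laplace T lam g x"
    using laplace_lincomb[OF _ w g, of lam lam "-1" x] lam by simp
  ultimately show "w x = laplace T lam (\<lambda>y. lam * w y - g y) x" by simp
qed

end

section \<open>Contractions on bounded measurable functions\<close>

lemma geometric_tail_bound:
  fixes v :: "nat \<Rightarrow> real"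
  assumes v: "\<And>k. \<bar>v k\<bar> \<le> q ^ k * B" and q: "0 \<le> q" "q < 1"
  shows "summable v" "\<bar>suminf v - (\<Sum>i<k. v i)\<bar> \<le> q ^ k * B / (1 - q)"
proof -
  have g: "summable (\<lambda>k. q ^ k * B)" using q by (intro summable_mult2 summable_geometric) auto
  then show sv: "summable v" by (rule summable_comparison_test'[where N=0]) (simp add: v)
  have b: "\<bar>v (n + k)\<bar> \<le> q ^ k * B * q ^ n" for n
    using v[of "n + k"] by (simp add: power_add ac_simps)
  have sg: "summable (\<lambda>n. q ^ k * B * q ^ n)"
    using q by (intro summable_mult summable_geometric) auto
  then have sa: "summable (\<lambda>n. \<bar>v (n + k)\<bar>)"
    by (rule summable_comparison_test'[where N=0]) (simp add: b)
  have "\<bar>\<Sum>n. v (n + k)\<bar> \<le> (\<Sum>n. \<bar>v (n + k)\<bar>)" by (rule summable_rabs[OF sa])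
  also have "\<dots> \<le> (\<Sum>n. q ^ k * B * q ^ n)" by (rule suminf_le[OF b sa sg])
  also have "\<dots> = q ^ k * B / (1 - q)"
    using q by (simp add: suminf_mult suminf_geometric summable_geometric)
  finally show "\<bar>suminf v - (\<Sum>i<k. v i)\<bar> \<le> q ^ k * B / (1 - q)"
    using suminf_minus_initial_segment[OF sv, of k] by simp
qed

locale Bb_contraction =
  fixes P :: "('a::topological_space \<Rightarrow> real) \<Rightarrow> 'a \<Rightarrow> real" and q :: real
  assumes q_nonneg: "0 \<le> q" and q_less_1: "q < 1"
    and lincomb: "\<And>f g a b. f \<in> Bb \<Longrightarrow> g \<in> Bb \<Longrightarrow> P (\<lambda>y. a * f y + b * g y) = (\<lambda>y. a * P f y + b * P g y)"
    and Bb_closed: "\<And>f. f \<in> Bb \<Longrightarrow> P f \<in> Bb"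
    and bound: "\<And>f B y. f \<in> Bb \<Longrightarrow> (\<And>y. \<bar>f y\<bar> \<le> B) \<Longrightarrow> \<bar>P f y\<bar> \<le> q * B"
begin

lemma add: "f \<in> Bb \<Longrightarrow> g \<in> Bb \<Longrightarrow> P (\<lambda>y. f y + g y) = (\<lambda>y. P f y + P g y)"
  using lincomb[of f g 1 1] by simp

lemma diff: "f \<in> Bb \<Longrightarrow> g \<in> Bb \<Longrightarrow> P (\<lambda>y. f y - g y) = (\<lambda>y. P f y - P g y)"
  using lincomb[of f g 1 "-1"] by simp

lemma funpow_Bb: "f \<in> Bb \<Longrightarrow> (P ^^ k) f \<in> Bb"
  by (induction k) (auto intro: Bb_closed)

lemma funpow_add: "f \<in> Bb \<Longrightarrow> g \<in> Bb \<Longrightarrow> (P ^^ k) (\<lambda>y. f y + g y) = (\<lambda>y. (P ^^ k) f y + (P ^^ k) g y)"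
  by (induction k) (simp_all add: add funpow_Bb)

lemma funpow_bound: "f \<in> Bb \<Longrightarrow> (\<And>y. \<bar>f y\<bar> \<le> B) \<Longrightarrow> \<bar>(P ^^ k) f y\<bar> \<le> q ^ k * B"
proof (induction k arbitrary: y)
  case (Suc k)
  then show ?case using bound[OF funpow_Bb[OF Suc.prems(1)] Suc.IH] by (simp add: ac_simps)
qed simp

lemma fixpoint_unique:
  assumes w1: "w1 \<in> Bb" "\<And>y. w1 y = f y + P w1 y" and w2: "w2 \<in> Bb" "\<And>y. w2 y = f y + P w2 y"
  shows "w1 = w2"
proof
  fix y
  define d where "d = (\<lambda>y. w1 y - w2 y)"
  have dB: "d \<in> Bb" unfolding d_def using Bb_diff[OF w1(1) w2(1)] .
  have "w1 y - w2 y = P w1 y - P w2 y" for y using w1(2)[of y] w2(2)[of y] by linarith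
  then have "d = (\<lambda>y. P w1 y - P w2 y)" by (simp add: d_def)
  also have "\<dots> = P d" by (simp add: d_def diff[OF w1(1) w2(1)])
  finally have "d = P d" .
  then have "d = (P ^^ k) d" for k by (induction k) auto
  moreover obtain B where "\<And>y. \<bar>d y\<bar> \<le> B" using dB unfolding Bb_def by blast
  ultimately have "\<bar>d y\<bar> \<le> q ^ k * B" for k using funpow_bound[OF dB] by metis
  moreover have "(\<lambda>k. q ^ k * B) \<longlonglongrightarrow> 0 * B"
    using q_nonneg q_less_1 by (intro tendsto_mult LIMSEQ_power_zero tendsto_const) auto
  ultimately have "\<bar>d y\<bar> \<le> 0" by (intro LIMSEQ_le_const[of "\<lambda>k. q ^ k * B"]) auto
  then show "w1 y = w2 y" by (simp add: d_def)
qed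

text \<open>The fixed point is the Neumann series \<open>\<Sum>\<^sub>k P\<^sup>k f\<close>.\<close>
lemma fixpoint_exists:
  assumes f: "f \<in> Bb" and Bf: "\<And>y. \<bar>f y\<bar> \<le> Bf"
  shows "\<exists>w\<in>Bb. (\<forall>y. w y = f y + P w y) \<and> (\<forall>y. \<bar>w y\<bar> \<le> Bf / (1 - q))"
proof -
  define S where "S n = (\<lambda>y. \<Sum>k<n. (P ^^ k) f y)" for n
  define w where "w y = (\<Sum>k. (P ^^ k) f y)" for y
  note tail = geometric_tail_bound[OF funpow_bound[OF f Bf] q_nonneg q_less_1]
  have SB: "S n \<in> Bb" for n
    by (induction n) (auto simp: S_def Bb_const intro!: Bb_add funpow_Bb f)
  have PS: "P (S n) = (\<lambda>y. S (Suc n) y - f y)" for n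
  proof (induction n)
    case 0
    then show ?case using lincomb[OF f f, of 0 0] by (simp add: S_def)
  next
    case (Suc n)
    have "S (Suc n) = (\<lambda>y. S n y + (P ^^ n) f y)" by (simp add: S_def)
    then show ?case using Suc add[OF SB funpow_Bb[OF f]] by (simp add: S_def fun_eq_iff algebra_simps)
  qed
  have wS: "\<bar>w y - S n y\<bar> \<le> q ^ n * Bf / (1 - q)" for n y
    unfolding w_def S_def by (rule tail(2))
  have "w \<in> borel_measurable borel"
    using funpow_Bb[OF f] unfolding Bb_def w_def by (intro borel_measurable_suminf) auto
  then have wB: "w \<in> Bb"
    using wS[of _ 0] unfolding Bb_def by (auto simp: S_def)
  have lim0: "(\<lambda>n. q * (q ^ n * Bf / (1 - q))) \<longlonglongrightarrow> q * (0 * Bf / (1 - q))"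
    using q_nonneg q_less_1 by (intro tendsto_intros LIMSEQ_power_zero) auto
  have "w y = f y + P w y" for y
  proof -
    have "\<bar>P w y - P (S n) y\<bar> \<le> q * (q ^ n * Bf / (1 - q))" for n
    proof -
      have "P w y - P (S n) y = P (\<lambda>y. w y - S n y) y" by (simp only: diff[OF wB SB])
      also have "\<bar>\<dots>\<bar> \<le> q * (q ^ n * Bf / (1 - q))" by (rule bound[OF Bb_diff[OF wB SB] wS])
      finally show ?thesis .
    qed
    then have "\<forall>\<^sub>F n in sequentially. norm (P w y - P (S n) y) \<le> q * (q ^ n * Bf / (1 - q))"
      by simp
    moreover have "(\<lambda>n. q * (q ^ n * Bf / (1 - q))) \<longlonglongrightarrow> 0" using lim0 by simp
    ultimately have "(\<lambda>n. P w y - P (S n) y) \<longlonglongrightarrow> 0"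
      by (rule Lim_null_comparison)
    from tendsto_diff[OF tendsto_const[of "P w y"] this]
    have "(\<lambda>n. S (Suc n) y - f y) \<longlonglongrightarrow> P w y" by (simp add: PS)
    moreover have "(\<lambda>n. S n y) \<longlonglongrightarrow> w y"
      unfolding S_def w_def by (rule summable_LIMSEQ[OF tail(1)])
    then have "(\<lambda>n. S (Suc n) y - f y) \<longlonglongrightarrow> w y - f y"
      by (intro tendsto_diff tendsto_const LIMSEQ_Suc)
    ultimately show ?thesis using LIMSEQ_unique by fastforce
  qed
  moreover have "\<bar>w y\<bar> \<le> Bf / (1 - q)" for y using wS[of y 0] by (simp add: S_def)
  ultimately show ?thesis using wB by blast
qed

lemma fixpoint_expansion:
  assumes d: "d \<in> Bb" and e: "e \<in> Bb" and de: "d = (\<lambda>y. e y + P d y)"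
  shows "d y = (\<Sum>i<K. (P ^^ i) e y) + (P ^^ K) d y"
proof (induction K arbitrary: y)
  case (Suc K)
  have "(P ^^ K) d = (\<lambda>y. (P ^^ K) e y + (P ^^ Suc K) d y)"
    by (subst de) (simp add: funpow_add[OF e Bb_closed[OF d]] funpow_Suc_right del: funpow.simps)
  from fun_cong[OF this, of y] show ?case using Suc.IH[of y] by simp
qed simp

end

lemma LIMSEQ_zero_geometric_remainder:
  fixes d :: "nat \<Rightarrow> real"
  assumes split: "\<And>n K. d n = a K n + r K n" and a: "\<And>K. a K \<longlonglongrightarrow> 0"
    and r: "\<And>K n. \<bar>r K n\<bar> \<le> q ^ K * C" and q: "0 \<le> q" "q < 1"
  shows "d \<longlonglongrightarrow> 0"
proof (rule LIMSEQ_I)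
  fix \<epsilon> :: real assume \<epsilon>: "0 < \<epsilon>"
  have "(\<lambda>K. q ^ K * C) \<longlonglongrightarrow> 0 * C"
    using q by (intro tendsto_mult LIMSEQ_power_zero tendsto_const) auto
  then obtain K where K: "q ^ K * C < \<epsilon> / 2"
    using order_tendstoD(2)[of _ 0 sequentially "\<epsilon> / 2"] \<epsilon> by (auto simp: eventually_sequentially)
  obtain N where N: "\<And>n. N \<le> n \<Longrightarrow> \<bar>a K n\<bar> < \<epsilon> / 2"
    using LIMSEQ_D[OF a[of K], of "\<epsilon> / 2"] \<epsilon> by auto
  have "norm (d n - 0) < \<epsilon>" if "N \<le> n" for n
    using split[of n K] N[OF that] r[of K n] K by simp
  then show "\<exists>N. \<forall>n\<ge>N. norm (d n - 0) < \<epsilon>" by blast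
qed

text \<open>Convergence of fixed points under hypotheses (2) and (3): the error \<open>d\<^sub>n = w\<^sub>n - w\<close> satisfies
  \<open>d\<^sub>n = e\<^sub>n + P\<^sub>n d\<^sub>n\<close> with \<open>e\<^sub>n \<rightharpoonup> 0\<close>; expanding \<open>K\<close> times, (3) kills each \<open>P\<^sub>n\<^sup>i e\<^sub>n\<close> and the
  remainder is at most \<open>q\<^sup>K\<close> times a uniform bound.\<close>
lemma Bb_contraction_fixpoints_bp_conv:
  assumes Pn: "\<And>n. Bb_contraction (Pn n) q" and P: "Bb_contraction P q"
    and conv: "\<And>h. h \<in> Bb \<Longrightarrow> bp_conv (\<lambda>n. Pn n h) (P h)"
    and asym: "\<And>hs. (\<forall>n. hs n \<in> Bb) \<Longrightarrow> bp_conv hs (\<lambda>x. 0) \<Longrightarrow> bp_conv (\<lambda>n. Pn n (hs n)) (\<lambda>x. 0)"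
    and w: "w \<in> Bb" "\<And>y. w y = f y + P w y"
    and wn: "\<And>n. wn n \<in> Bb" "\<And>n y. wn n y = f y + Pn n (wn n) y"
    and bd: "\<And>n y. \<bar>wn n y\<bar> \<le> D" "\<And>y. \<bar>w y\<bar> \<le> D"
  shows "bp_conv (\<lambda>n y. wn n y - w y) (\<lambda>x. 0)"
proof -
  interpret P: Bb_contraction P q by (rule P)
  define d where "d n = (\<lambda>y. wn n y - w y)" for n
  define e where "e n = (\<lambda>y. Pn n w y - P w y)" for n
  have dB: "d n \<in> Bb" for n unfolding d_def by (rule Bb_diff[OF wn(1) w(1)])
  have eB: "e n \<in> Bb" for n
    unfolding e_def by (rule Bb_diff[OF Bb_contraction.Bb_closed[OF Pn w(1)] P.Bb_closed[OF w(1)]])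
  have db: "\<bar>d n y\<bar> \<le> 2 * D" for n y unfolding d_def using bd(1)[of n y] bd(2)[of y] by linarith
  have "bp_conv e (\<lambda>x. 0)"
  proof -
    obtain C where C: "\<And>n x. \<bar>Pn n w x\<bar> \<le> C" and l: "\<And>x. (\<lambda>n. Pn n w x) \<longlonglongrightarrow> P w x"
      using conv[OF w(1)] unfolding bp_conv_def by blast
    obtain C' where C': "\<And>x. \<bar>P w x\<bar> \<le> C'" using P.Bb_closed[OF w(1)] unfolding Bb_def by blast
    have "\<bar>e n x\<bar> \<le> C + C'" for n x unfolding e_def using C[of n x] C'[of x] by linarith
    moreover have "(\<lambda>n. e n x) \<longlonglongrightarrow> 0" for x
      using tendsto_diff[OF l[of x] tendsto_const[of "P w x"]] by (simp add: e_def)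
    ultimately show ?thesis unfolding bp_conv_def by blast
  qed
  then have Ebp: "bp_conv (\<lambda>n. (Pn n ^^ i) (e n)) (\<lambda>x. 0)" for i
    by (induction i) (auto intro!: asym Bb_contraction.funpow_Bb[OF Pn eB])
  have expand: "d n y = (\<Sum>i<K. (Pn n ^^ i) (e n) y) + (Pn n ^^ K) (d n) y" for n K y
  proof (rule Bb_contraction.fixpoint_expansion[OF Pn dB eB])
    show "d n = (\<lambda>y. e n y + Pn n (d n) y)"
    proof
      fix y
      have "Pn n (d n) y = Pn n (wn n) y - Pn n w y"
        unfolding d_def Bb_contraction.diff[OF Pn wn(1) w(1)] ..
      moreover have "d n y = wn n y - w y" "e n y = Pn n w y - P w y" by (simp_all add: d_def e_def)
      ultimately show "d n y = e n y + Pn n (d n) y" using wn(2)[of n y] w(2)[of y] by linarith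
    qed
  qed
  have "(\<lambda>n. d n y) \<longlonglongrightarrow> 0" for y
  proof (rule LIMSEQ_zero_geometric_remainder)
    show "d n y = (\<Sum>i<K. (Pn n ^^ i) (e n) y) + (Pn n ^^ K) (d n) y" for n K
      by (rule expand)
    show "(\<lambda>n. \<Sum>i<K. (Pn n ^^ i) (e n) y) \<longlonglongrightarrow> 0" for K
      using tendsto_sum[of "{..<K}" "\<lambda>i n. (Pn n ^^ i) (e n) y" "\<lambda>i. 0"] Ebp
      unfolding bp_conv_def by simp
    show "\<bar>(Pn n ^^ K) (d n) y\<bar> \<le> q ^ K * (2 * D)" for K n
      by (rule Bb_contraction.funpow_bound[OF Pn dB db])
  qed (fact P.q_nonneg P.q_less_1)+
  then show ?thesis unfolding bp_conv_def d_def using db unfolding d_def by blast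
qed

section \<open>Uniform convergence on compacts\<close>

lemma Dini_decreasing:
  fixes g :: "nat \<Rightarrow> 'a::topological_space \<Rightarrow> real"
  assumes K: "compact K" and cont: "\<And>N. continuous_on UNIV (g N)"
    and mono: "\<And>N N' x. N \<le> N' \<Longrightarrow> g N' x \<le> g N x" and lim: "\<And>x. (\<lambda>N. g N x) \<longlonglongrightarrow> 0"
    and e: "0 < e"
  shows "\<exists>N. \<forall>n\<ge>N. \<forall>x\<in>K. g n x < e"
proof -
  define U where "U N = {x. g N x < e}" for N
  have "open (U N)" for N unfolding U_def by (rule open_Collect_less[OF cont continuous_on_const])
  moreover have "K \<subseteq> (\<Union>N. U N)"
    using order_tendstoD(2)[OF lim e] by (auto simp: U_def eventually_sequentially) (meson order_refl)
  ultimately obtain C where C: "finite C" "K \<subseteq> (\<Union>N\<in>C. U N)"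
    using compactE_image[OF K] by metis
  have "\<forall>x\<in>K. g n x < e" if "Max (insert 0 C) \<le> n" for n
  proof
    fix x assume "x \<in> K"
    then obtain c where c: "c \<in> C" "g c x < e" using C(2) by (auto simp: U_def)
    have "c \<le> n" using Max_ge[of "insert 0 C" c] C(1) c(1) that by auto
    then show "g n x < e" using mono[of c n x] c(2) by simp
  qed
  then show ?thesis by blast
qed

lemma bp_conv_zero_envelope:
  fixes d :: "nat \<Rightarrow> 'a::topological_space \<Rightarrow> real"
  assumes dB: "\<And>n. d n \<in> Bb" and dc: "bp_conv d (\<lambda>x. 0)"
  obtains \<phi> where "\<And>N. \<phi> N \<in> Bb" "\<And>N n y. N \<le> n \<Longrightarrow> \<bar>d n y\<bar> \<le> \<phi> N y"
    "\<And>N N' y. N \<le> N' \<Longrightarrow> \<phi> N' y \<le> \<phi> N y" "bp_conv \<phi> (\<lambda>x. 0)"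
proof -
  define \<phi> where "\<phi> N y = (SUP m\<in>{N..}. \<bar>d m y\<bar>)" for N y
  obtain D where D: "\<And>n y. \<bar>d n y\<bar> \<le> D" and dl: "\<And>y. (\<lambda>n. d n y) \<longlonglongrightarrow> 0"
    using dc unfolding bp_conv_def by blast
  have bdd: "bdd_above ((\<lambda>m. \<bar>d m y\<bar>) ` A)" for y A using D by (intro bdd_aboveI[where M=D]) auto
  have ge: "\<bar>d n y\<bar> \<le> \<phi> N y" if "N \<le> n" for N n y
    unfolding \<phi>_def by (rule cSUP_upper) (use that bdd in auto)
  have le: "\<phi> N y \<le> D" for N y unfolding \<phi>_def using D by (intro cSUP_least) auto
  have nonneg: "0 \<le> \<phi> N y" for N y using ge[of N N y] by linarith
  have mono: "\<phi> N' y \<le> \<phi> N y" if "N \<le> N'" for N N' y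
    unfolding \<phi>_def using that bdd by (intro cSUP_subset_mono) auto
  have "(\<lambda>y. \<bar>d m y\<bar>) \<in> borel_measurable borel" for m
    using dB[of m] unfolding Bb_def by (intro borel_measurable_abs) blast
  then have "(\<lambda>y. SUP m\<in>{N..}. \<bar>d m y\<bar>) \<in> borel_measurable borel" for N
    using bdd by (intro borel_measurable_cSUP) auto
  then have \<phi>B: "\<phi> N \<in> Bb" for N
    unfolding Bb_def using le nonneg by (auto simp: \<phi>_def[abs_def] intro!: exI[of _ D])
  have "(\<lambda>N. \<phi> N y) \<longlonglongrightarrow> 0" for y
  proof (rule LIMSEQ_I)
    fix r :: real assume r: "0 < r"
    obtain N0 where N0: "\<And>n. n \<ge> N0 \<Longrightarrow> \<bar>d n y\<bar> < r / 2"
      using LIMSEQ_D[OF dl[of y], of "r/2"] r by auto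
    have "norm (\<phi> N y - 0) < r" if "N0 \<le> N" for N
    proof -
      have "\<phi> N y \<le> r / 2"
        unfolding \<phi>_def using N0 that by (intro cSUP_least) (auto intro: less_imp_le)
      then show ?thesis using nonneg[of N y] r by simp
    qed
    then show "\<exists>no. \<forall>N\<ge>no. norm (\<phi> N y - 0) < r" by blast
  qed
  then have "bp_conv \<phi> (\<lambda>x. 0)" unfolding bp_conv_def using le nonneg by (auto intro!: exI[of _ D])
  from that[OF \<phi>B ge mono this] show thesis .
qed

text \<open>A positive operator into continuous functions dominates \<open>\<bar>R (d\<^sub>n)\<bar>\<close> by the decreasing
  continuous functions \<open>R (sup\<^sub>m\<^sub>\<ge>\<^sub>N \<bar>d\<^sub>m\<bar>)\<close>, to which Dini's theorem applies.\<close>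
lemma positive_operator_uniform_limit:
  fixes R :: "('a::topological_space \<Rightarrow> real) \<Rightarrow> 'a \<Rightarrow> real"
  assumes lin: "\<And>f g a b x. f \<in> Bb \<Longrightarrow> g \<in> Bb \<Longrightarrow> R (\<lambda>y. a * f y + b * g y) x = a * R f x + b * R g x"
    and pos: "\<And>f x. f \<in> Bb \<Longrightarrow> \<forall>y. 0 \<le> f y \<Longrightarrow> 0 \<le> R f x"
    and cont: "\<And>f. f \<in> Bb \<Longrightarrow> continuous_on UNIV (R f)"
    and dct: "\<And>F f B x. (\<And>n. F n \<in> Bb) \<Longrightarrow> f \<in> Bb \<Longrightarrow> (\<And>n y. \<bar>F n y\<bar> \<le> B) \<Longrightarrow>
               (\<And>y. (\<lambda>n. F n y) \<longlonglongrightarrow> f y) \<Longrightarrow> (\<lambda>n. R (F n) x) \<longlonglongrightarrow> R f x"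
    and dB: "\<And>n. d n \<in> Bb" and dc: "bp_conv d (\<lambda>x. 0)" and K: "compact K"
  shows "uniform_limit K (\<lambda>n. R (d n)) (\<lambda>x. 0) sequentially"
proof -
  obtain \<phi> where \<phi>: "\<And>N. \<phi> N \<in> Bb" "\<And>N n y. N \<le> n \<Longrightarrow> \<bar>d n y\<bar> \<le> \<phi> N y"
    "\<And>N N' y. N \<le> N' \<Longrightarrow> \<phi> N' y \<le> \<phi> N y" "bp_conv \<phi> (\<lambda>x. 0)"
    using bp_conv_zero_envelope[OF dB dc] by blast
  have R0: "R (\<lambda>y. 0) x = 0" for x using lin[OF Bb_const Bb_const, of 0 0 0 0 x] by simp
  have Rdiff: "R (\<lambda>y. f y - g y) x = R f x - R g x" if "f \<in> Bb" "g \<in> Bb" for f g x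
    using lin[OF that, of 1 "-1" x] by simp
  have Radd: "R (\<lambda>y. f y + g y) x = R f x + R g x" if "f \<in> Bb" "g \<in> Bb" for f g x
    using lin[OF that, of 1 1 x] by simp
  have "R (\<phi> N') x \<le> R (\<phi> N) x" if "N \<le> N'" for N N' x
    using pos[OF Bb_diff[OF \<phi>(1) \<phi>(1)], of N N' x] \<phi>(3)[OF that] Rdiff[OF \<phi>(1) \<phi>(1), of N N' x] by simp
  moreover have "(\<lambda>N. R (\<phi> N) x) \<longlonglongrightarrow> 0" for x
  proof -
    obtain C where "\<And>N y. \<bar>\<phi> N y\<bar> \<le> C" "\<And>y. (\<lambda>N. \<phi> N y) \<longlonglongrightarrow> 0"
      using \<phi>(4) unfolding bp_conv_def by blast
    from dct[OF \<phi>(1) Bb_const this] show ?thesis by (simp add: R0)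
  qed
  ultimately have Dini: "\<exists>N. \<forall>n\<ge>N. \<forall>x\<in>K. R (\<phi> n) x < e" if "0 < e" for e
    using K that by (intro Dini_decreasing cont \<phi>(1))
  have dom: "\<bar>R (d n) x\<bar> \<le> R (\<phi> N) x" if "N \<le> n" for N n x
  proof -
    have "0 \<le> \<phi> N y - d n y" "0 \<le> \<phi> N y + d n y" for y
      using \<phi>(2)[OF that, of y] by (simp_all add: abs_le_iff)
    then have "0 \<le> R (\<lambda>y. \<phi> N y - d n y) x" "0 \<le> R (\<lambda>y. \<phi> N y + d n y) x"
      using pos[OF Bb_diff[OF \<phi>(1) dB]] pos[OF Bb_add[OF \<phi>(1) dB]] by blast+
    then show ?thesis using Rdiff[OF \<phi>(1) dB, of N n x] Radd[OF \<phi>(1) dB, of N n x] by linarith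
  qed
  show ?thesis unfolding uniform_limit_iff
  proof (intro allI impI)
    fix e :: real assume "0 < e"
    then obtain N where N: "\<And>n x. N \<le> n \<Longrightarrow> x \<in> K \<Longrightarrow> R (\<phi> n) x < e" using Dini by blast
    have "dist (R (d n) x) 0 < e" if "N \<le> n" "x \<in> K" for n x
      using N[OF that] dom[of n n x] by (simp add: dist_real_def)
    then show "\<forall>\<^sub>F n in sequentially. \<forall>x\<in>K. dist (R (d n) x) 0 < e"
      unfolding eventually_sequentially by blast
  qed
qed

section \<open>Resolvents of perturbed generators\<close>

lemma rel_inv_lam_minus_rel_plus_iff:
  "(f, v) \<in> rel_inv (lam_minus lam (rel_plus A B')) \<longleftrightarrow> (\<exists>g. (v, g) \<in> A \<and> f = (\<lambda>x. lam * v x - (g x + B' v x)))"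
  by (auto simp: rel_inv_def lam_minus_def rel_plus_def)

context strong_feller_semigroup
begin

lemma perturbed_resolvent_iff:
  assumes lam: "max \<omega> 0 < lam"
    and C: "Bb_contraction (\<lambda>h. B' (laplace T lam h)) q" and f: "f \<in> Bb"
    and w: "w \<in> Bb" "\<And>y. w y = f y + B' (laplace T lam w) y"
  shows "(f, v) \<in> rel_inv (lam_minus lam (rel_plus (full_gen T) B')) \<longleftrightarrow> v = laplace T lam w"
proof
  assume "(f, v) \<in> rel_inv (lam_minus lam (rel_plus (full_gen T) B'))"
  then obtain g where vg: "(v, g) \<in> full_gen T" and fe: "f = (\<lambda>x. lam * v x - (g x + B' v x))"
    unfolding rel_inv_lam_minus_rel_plus_iff by blast
  define h where "h = (\<lambda>y. lam * v y - g y)"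
  have "v \<in> Bb" "g \<in> Bb" using vg unfolding full_gen_def by auto
  then have hB: "h \<in> Bb" unfolding h_def using Bb_lincomb[of v g lam "-1"] by simp
  have vR: "v = laplace T lam h" unfolding h_def by (rule full_gen_eq_laplace[OF vg lam])
  have "h y = f y + B' (laplace T lam h) y" for y
    using fe vR[symmetric] by (simp add: h_def)
  then have "h = w" using Bb_contraction.fixpoint_unique[OF C hB _ w] by blast
  then show "v = laplace T lam w" using vR by simp
next
  assume "v = laplace T lam w"
  moreover have "f = (\<lambda>x. lam * laplace T lam w x - ((lam * laplace T lam w x - w x) + B' (laplace T lam w) x))"
    using w(2) by (auto simp: fun_eq_iff)
  ultimately show "(f, v) \<in> rel_inv (lam_minus lam (rel_plus (full_gen T) B'))"
    unfolding rel_inv_lam_minus_rel_plus_iff using laplace_in_full_gen[OF w(1) lam] by blast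
qed

lemma admissible_pert_Bb_contraction:
  assumes lam: "max \<omega> 0 < lam" and ad: "admissible_pert T \<omega> B' BT'" and q: "0 \<le> q" "q < 1"
    and bd: "\<And>h y Bh. h \<in> Bb \<Longrightarrow> (\<And>y. \<bar>h y\<bar> \<le> Bh) \<Longrightarrow> \<bar>B' (laplace T lam h) y\<bar> \<le> q * Bh"
  shows "Bb_contraction (\<lambda>h. B' (laplace T lam h)) q"
proof
  have "kernel_op (\<lambda>f. B' (laplace T lam f))" using ad lam unfolding admissible_pert_def by simp
  then obtain C where C: "kernel_repr (\<lambda>f. B' (laplace T lam f)) C" using kernel_op_imp_kernel_repr by blast
  show "B' (laplace T lam (\<lambda>y. a * f y + b * g y)) = (\<lambda>y. a * B' (laplace T lam f) y + b * B' (laplace T lam g) y)"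
    if "f \<in> Bb" "g \<in> Bb" for f g a b
    using kernel_repr_lincomb[OF C that] by (auto simp: fun_eq_iff)
  show "B' (laplace T lam f) \<in> Bb" if "f \<in> Bb" for f
    using laplace_in_full_gen[OF that lam] ad unfolding admissible_pert_def by blast
qed (fact q bd)+

lemma admissible_pert_abs_le_opn:
  assumes "\<omega> < lam" "admissible_pert T \<omega> B' BT'" "h \<in> Bb" "\<And>y. \<bar>h y\<bar> \<le> Bh"
  shows "\<bar>B' (laplace T lam h) y\<bar> \<le> opn (\<lambda>f. B' (laplace T lam f)) * Bh"
proof -
  have "kernel_op (\<lambda>f. B' (laplace T lam f))" using assms(1,2) unfolding admissible_pert_def by simp
  then obtain C where "kernel_repr (\<lambda>f. B' (laplace T lam f)) C" using kernel_op_imp_kernel_repr by blast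
  from kernel_repr_abs_le_opn[OF this assms(3,4)] show ?thesis .
qed

lemma perturbed_resolvent_convergence:
  assumes lam: "max \<omega> 0 < lam"
    and adB: "admissible_pert T \<omega> B BT" and adBn: "\<And>n. admissible_pert T \<omega> (Bn n) (BnT n)"
    and q: "0 \<le> q" "q < 1" and opn: "\<And>n. opn (\<lambda>f. Bn n (laplace T lam f)) \<le> q"
    and conv: "\<And>h. h \<in> Bb \<Longrightarrow> bp_conv (\<lambda>n. Bn n (laplace T lam h)) (B (laplace T lam h))"
    and asym: "\<And>hs. (\<forall>n. hs n \<in> Bb) \<Longrightarrow> bp_conv hs (\<lambda>x. 0) \<Longrightarrow>
                 bp_conv (\<lambda>n. Bn n (laplace T lam (hs n))) (\<lambda>x. 0)"
    and pos: "\<And>f x. f \<in> Bb \<Longrightarrow> \<forall>y. 0 \<le> f y \<Longrightarrow> 0 \<le> laplace T lam f x"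
    and f: "f \<in> Bb"
  shows "\<exists>u us. (\<forall>v. (f, v) \<in> rel_inv (lam_minus lam (rel_plus (full_gen T) B)) \<longleftrightarrow> v = u) \<and>
           (\<forall>n v. (f, v) \<in> rel_inv (lam_minus lam (rel_plus (full_gen T) (Bn n))) \<longleftrightarrow> v = us n) \<and>
           (\<forall>K. compact K \<longrightarrow> uniform_limit K us u sequentially)"
proof -
  have lam': "\<omega> < lam" using lam by simp
  have bdn: "\<bar>Bn n (laplace T lam h) y\<bar> \<le> q * Bh" if h: "h \<in> Bb" "\<And>y. \<bar>h y\<bar> \<le> Bh" for n h y Bh
  proof -
    have "0 \<le> Bh" using h(2)[of undefined] by linarith
    with opn[of n] have "opn (\<lambda>f. Bn n (laplace T lam f)) * Bh \<le> q * Bh" by (rule mult_right_mono)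
    with admissible_pert_abs_le_opn[OF lam' adBn[of n] h] show ?thesis by (rule order_trans)
  qed
  then have Pn: "Bb_contraction (\<lambda>h. Bn n (laplace T lam h)) q" for n
    using admissible_pert_Bb_contraction[OF lam adBn q] by blast
  have "\<bar>B (laplace T lam h) y\<bar> \<le> q * Bh" if h: "h \<in> Bb" "\<And>y. \<bar>h y\<bar> \<le> Bh" for h y Bh
  proof (rule LIMSEQ_le_const2)
    show "(\<lambda>n. \<bar>Bn n (laplace T lam h) y\<bar>) \<longlonglongrightarrow> \<bar>B (laplace T lam h) y\<bar>"
      using conv[OF h(1)] unfolding bp_conv_def by (intro tendsto_rabs) blast
  qed (use bdn[OF h] in blast)
  then have P: "Bb_contraction (\<lambda>h. B (laplace T lam h)) q"
    using admissible_pert_Bb_contraction[OF lam adB q] by blast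
  obtain Bf where Bf: "\<And>y. \<bar>f y\<bar> \<le> Bf" using f unfolding Bb_def by blast
  obtain w where w: "w \<in> Bb" "\<And>y. w y = f y + B (laplace T lam w) y" "\<And>y. \<bar>w y\<bar> \<le> Bf / (1 - q)"
    using Bb_contraction.fixpoint_exists[OF P f Bf] by blast
  have "\<forall>n. \<exists>w. w \<in> Bb \<and> (\<forall>y. w y = f y + Bn n (laplace T lam w) y) \<and> (\<forall>y. \<bar>w y\<bar> \<le> Bf / (1 - q))"
    using Bb_contraction.fixpoint_exists[OF Pn f Bf] by blast
  then obtain wn where wn: "\<And>n. wn n \<in> Bb" "\<And>n y. wn n y = f y + Bn n (laplace T lam (wn n)) y"
    "\<And>n y. \<bar>wn n y\<bar> \<le> Bf / (1 - q)"
    by metis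
  have unif: "uniform_limit K (\<lambda>n. laplace T lam (\<lambda>y. wn n y - w y)) (\<lambda>x. 0) sequentially"
    if "compact K" for K
    by (rule positive_operator_uniform_limit[OF laplace_lincomb[OF lam'] pos laplace_continuous[OF lam']
          laplace_bounded_convergence[OF lam'] Bb_diff[OF wn(1) w(1)]
          Bb_contraction_fixpoints_bp_conv[OF Pn P conv asym w(1,2) wn(1,2) wn(3) w(3)] that])
  have "dist (laplace T lam (wn n) x) (laplace T lam w x) = dist (laplace T lam (\<lambda>y. wn n y - w y) x) 0" for n x
    by (simp add: dist_real_def laplace_diff[OF lam' wn(1) w(1)])
  then have "uniform_limit K (\<lambda>n. laplace T lam (wn n)) (laplace T lam w) sequentially" if "compact K" for K
    using unif[OF that] unfolding uniform_limit_iff by simp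
  moreover have "(f, v) \<in> rel_inv (lam_minus lam (rel_plus (full_gen T) B)) \<longleftrightarrow> v = laplace T lam w" for v
    by (rule perturbed_resolvent_iff[OF lam P f w(1,2)])
  moreover have "(f, v) \<in> rel_inv (lam_minus lam (rel_plus (full_gen T) (Bn n))) \<longleftrightarrow> v = laplace T lam (wn n)"
    for n v by (rule perturbed_resolvent_iff[OF lam Pn f wn(1,2)])
  ultimately show ?thesis
    by (intro exI[of _ "laplace T lam w"] exI[of _ "\<lambda>n. laplace T lam (wn n)"]) simp
qed

end

theorem corollary5p3:
  fixes T :: "real \<Rightarrow> ('a::polish_space \<Rightarrow> real) \<Rightarrow> ('a \<Rightarrow> real)"
    and M \<omega> :: real
    and B :: "('a \<Rightarrow> real) \<Rightarrow> ('a \<Rightarrow> real)"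
    and BT :: "real \<Rightarrow> ('a \<Rightarrow> real) \<Rightarrow> ('a \<Rightarrow> real)"
    and Bn :: "nat \<Rightarrow> ('a \<Rightarrow> real) \<Rightarrow> ('a \<Rightarrow> real)"
    and BnT :: "nat \<Rightarrow> real \<Rightarrow> ('a \<Rightarrow> real) \<Rightarrow> ('a \<Rightarrow> real)"
  assumes lc: "locally_compact_space (euclidean :: 'a topology)"
    and sg: "kernel_semigroup T M \<omega>"
    and cb: "Cb_semigroup T"
    and sf: "\<forall>t>0. strong_feller (T t)"
    and adB: "admissible_pert T \<omega> B BT"
    and adBn: "\<forall>n. admissible_pert T \<omega> (Bn n) (BnT n)"
    and h1: "\<forall>\<epsilon>>0. \<exists>lam0. \<forall>lam\<ge>lam0. \<forall>n. opn (\<lambda>f. Bn n (laplace T lam f)) \<le> \<epsilon>"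
    and h2: "\<exists>lam0. \<forall>lam\<ge>lam0. \<forall>h\<in>Bb.
               bp_conv (\<lambda>n. Bn n (laplace T lam h)) (B (laplace T lam h))"
    and h3: "\<exists>lam0. \<forall>lam\<ge>lam0. \<forall>hs. (\<forall>n. hs n \<in> Bb) \<and> bp_conv hs (\<lambda>x. 0)
               \<longrightarrow> bp_conv (\<lambda>n. Bn n (laplace T lam (hs n))) (\<lambda>x. 0)"
    and pos: "\<exists>lam0. \<forall>lam\<ge>lam0. \<forall>f\<in>Bb. (\<forall>x. f x \<ge> 0) \<longrightarrow> (\<forall>x. laplace T lam f x \<ge> 0)"
  shows "\<exists>lam0. \<forall>lam\<ge>lam0. \<forall>f\<in>Bb. \<exists>u us.
           (\<forall>v. (f, v) \<in> rel_inv (lam_minus lam (rel_plus (full_gen T) B)) \<longleftrightarrow> v = u) \<and>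
           (\<forall>n v. (f, v) \<in> rel_inv (lam_minus lam (rel_plus (full_gen T) (Bn n))) \<longleftrightarrow> v = us n) \<and>
           (\<forall>K. compact K \<longrightarrow> uniform_limit K us u sequentially)"
proof -
  interpret strong_feller_semigroup T M \<omega> using sg sf by unfold_locales
  obtain l1 where l1: "\<And>lam n. l1 \<le> lam \<Longrightarrow> opn (\<lambda>f. Bn n (laplace T lam f)) \<le> 1/2"
    using h1[rule_format, of "1/2"] by auto
  obtain l2 where l2: "\<And>lam h. l2 \<le> lam \<Longrightarrow> h \<in> Bb \<Longrightarrow>
      bp_conv (\<lambda>n. Bn n (laplace T lam h)) (B (laplace T lam h))"
    using h2 by blast
  obtain l3 where l3: "\<And>lam hs. l3 \<le> lam \<Longrightarrow> \<forall>n. hs n \<in> Bb \<Longrightarrow> bp_conv hs (\<lambda>x. 0) \<Longrightarrow>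
      bp_conv (\<lambda>n. Bn n (laplace T lam (hs n))) (\<lambda>x. 0)"
    using h3 by blast
  obtain l4 where l4: "\<And>lam f x. l4 \<le> lam \<Longrightarrow> f \<in> Bb \<Longrightarrow> \<forall>y. 0 \<le> f y \<Longrightarrow> 0 \<le> laplace T lam f x"
    using pos by blast
  define lam0 where "lam0 = max (max l1 l2) (max (max l3 l4) (max (\<omega> + 1) 1))"
  show ?thesis
  proof (intro exI[of _ lam0] allI impI ballI)
    fix lam :: real and f :: "'a \<Rightarrow> real" assume "lam0 \<le> lam" and f: "f \<in> Bb"
    then have lam: "l1 \<le> lam" "l2 \<le> lam" "l3 \<le> lam" "l4 \<le> lam" "max \<omega> 0 < lam"
      by (auto simp: lam0_def)
    show "\<exists>u us. (\<forall>v. (f, v) \<in> rel_inv (lam_minus lam (rel_plus (full_gen T) B)) \<longleftrightarrow> v = u) \<and>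
        (\<forall>n v. (f, v) \<in> rel_inv (lam_minus lam (rel_plus (full_gen T) (Bn n))) \<longleftrightarrow> v = us n) \<and>
        (\<forall>K. compact K \<longrightarrow> uniform_limit K us u sequentially)"
      by (rule perturbed_resolvent_convergence[OF lam(5) adB adBn[rule_format] _ _ l1[OF lam(1)]
            l2[OF lam(2)] l3[OF lam(3)] l4[OF lam(4)] f]) auto
  qed
qed

end
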